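(* Consider a linear network with $L\ge 2$ links of capacity $1$, with arrival rates $\lambda_k>0$ and inverse mean flow sizes $\mu_k>0$, $0\le k\le L$, whose traffic intensities $\rho_k=\lambda_k/\mu_k$ satisfy the optimal stability conditions $$\rho_0+\rho_k<1\qquad\text{for } 1\le k\le L.$$ If the access rates $(a_0,\dots,a_L)$ are small enough, then the resulting stochastic process $(N(t))$ is ergodic; that is, there exists $\varepsilon>0$ such that $(N(t))$ is ergodic whenever $0<a_k\le\varepsilon$ for all $0\le k\le L$.
   Context: Linear network: there are $L$ links labelled $1,\dots,L$, each of capacity $1$, and $K=L+1$ classes of flows $0,1,\dots,L$. Class $0$ goes through links $1,2,\dots,L$ in this order; class $l$ ($1\le l\le L$) goes through link $l$ only. Class $k$ has access rate $a_k>0$. For $x=(x_0,\dots,x_L)\in\mathbb{R}_+^{L+1}$ define $\theta_0^0(x)=x_0$ and, for $1\le k\le L$, $$\theta_0^k(x)=\min\Big(\theta_0^{k-1}(x),\tfrac{\theta_0^{k-1}(x)}{\theta_0^{k-1}(x)+x_k}\Big),\qquad \psi_k(x)=\min\Big(x_k,\tfrac{x_k}{\theta_0^{k-1}(x)+x_k}\Big),$$ and $\psi_0(x)=\theta_0^L(x)$ (with the convention that each minimum is $0$ when its denominator is $0$). Put $\phi_k(n)=\psi_k(a_0n_0,\dots,a_Ln_L)$ for $n\in\mathbb{N}^{L+1}$. $(N(t))$ is the Markov jump process on $\mathbb{N}^{L+1}$ with transitions $n\to n+e_k$ at rate $\lambda_k$ and $n\to n-e_k$ at rate $\mu_k\phi_k(n)$,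 $0\le k\le L$ ($e_k$ is the unit vector of coordinate $k$). Ergodic means positive recurrent. *)

theory Defs
  imports "HOL-Probability.Probability"
begin

section \<open>Markov jump processes with given transition rates\<close>

text \<open>
  A Markov jump process is given by its transition rates \<open>q i j\<close>, \<open>i \<noteq> j\<close>, and is constructed from
  its embedded jump chain and its holding times. The definitions are meant for conservative rates
  without absorbing states, i.e. \<open>0 \<le> q i j\<close> and \<open>0 < exit_rate q i < \<infinity>\<close>; the diagonal
  entries \<open>q i i\<close> are never used.
\<close>

definition exit_rate :: "('s \<Rightarrow> 's \<Rightarrow> real) \<Rightarrow> 's \<Rightarrow> real" where
  "exit_rate q i = (\<Sum>\<^sub>\<infinity>j\<in>-{i}. q i j)"

definition jump_pmf :: "('s \<Rightarrow> 's \<Rightarrow> real) \<Rightarrow> 's \<Rightarrow> 's pmf" where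
  "jump_pmf q i = embed_pmf (\<lambda>j. if j = i then 0 else q i j / exit_rate q i)"

abbreviation step_space :: "('s \<times> real) measure" where
  "step_space \<equiv> count_space UNIV \<Otimes>\<^sub>M borel"

definition stay :: "('s \<Rightarrow> 's \<Rightarrow> real) \<Rightarrow> 's \<Rightarrow> ('s \<times> real) measure" where
  "stay q i =
     distr (density lborel (exponential_density (exit_rate q i))) step_space (\<lambda>s. (i, s))"

text \<open>
  A path is a sequence \<open>\<omega>\<close> whose \<open>n\<close>-th entry consists of the state entered at the \<open>n\<close>-th jump and of
  the time spent there. The kernel gives the conditional law of entry \<open>n\<close> given the entries before.
\<close>

fun path_kernel ::
  "('s \<Rightarrow> 's \<Rightarrow> real) \<Rightarrow> 's \<Rightarrow> nat \<Rightarrow> (nat \<Rightarrow> 's \<times> real) \<Rightarrow> ('s \<times> real) measure" where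
  "path_kernel q i 0 \<omega> = stay q i"
| "path_kernel q i (Suc n) \<omega> = measure_pmf (jump_pmf q (fst (\<omega> n))) \<bind> stay q"

text \<open>
  The law of the process started in \<open>i\<close> is the Ionescu-Tulcea measure of these kernels.
\<close>

definition path_law :: "('s \<Rightarrow> 's \<Rightarrow> real) \<Rightarrow> 's \<Rightarrow> (nat \<Rightarrow> 's \<times> real) measure" where
  "path_law q i =
     projective_family.lim UNIV
       (Ionescu_Tulcea.CI (path_kernel q i) (\<lambda>_. step_space)) (\<lambda>_. step_space)"

definition jump_time :: "(nat \<Rightarrow> 's \<times> real) \<Rightarrow> nat \<Rightarrow> real" where
  "jump_time \<omega> n = (\<Sum>m<n. snd (\<omega> m))"

text \<open>The value \<open>None\<close> is taken after an explosion.\<close>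

definition state_at :: "(nat \<Rightarrow> 's \<times> real) \<Rightarrow> real \<Rightarrow> 's option" where
  "state_at \<omega> t =
     (if \<exists>n. t < jump_time \<omega> (Suc n)
      then Some (fst (\<omega> (LEAST n. t < jump_time \<omega> (Suc n)))) else None)"

text \<open>
  The first passage time to \<open>i\<close> after the first jump; for a process started in \<open>i\<close> this is the
  return time. It is \<open>\<infinity>\<close> if \<open>i\<close> is not visited after the first jump.
\<close>

definition return_time :: "'s \<Rightarrow> (nat \<Rightarrow> 's \<times> real) \<Rightarrow> ennreal" where
  "return_time i \<omega> = Inf {ennreal t | t. jump_time \<omega> 1 \<le> t \<and> state_at \<omega> t = Some i}"

definition positive_recurrent :: "('s \<Rightarrow> 's \<Rightarrow> real) \<Rightarrow> 's \<Rightarrow> bool" where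
  "positive_recurrent q i \<longleftrightarrow> (\<integral>\<^sup>+\<omega>. return_time i \<omega> \<partial>path_law q i) < \<infinity>"

definition ergodic :: "'s set \<Rightarrow> ('s \<Rightarrow> 's \<Rightarrow> real) \<Rightarrow> bool" where
  "ergodic S q \<longleftrightarrow> (\<forall>i\<in>S. positive_recurrent q i)"

lemma pmf_jump_pmf:
  assumes nonneg: "\<And>j. 0 \<le> q i j"
    and fin: "finite {j. q i j \<noteq> 0}"
    and pos: "0 < exit_rate q i"
  shows "pmf (jump_pmf q i) j = (if j = i then 0 else q i j / exit_rate q i)"
proof -
  let ?A = "{j. q i j \<noteq> 0} - {i}"
  let ?f = "\<lambda>j. if j = i then 0 else q i j / exit_rate q i"
  have A: "finite ?A" using fin by simp
  have "exit_rate q i = infsum (q i) ?A"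
    unfolding exit_rate_def by (rule infsum_cong_neutral) auto
  then have ex: "exit_rate q i = (\<Sum>j\<in>?A. q i j)"
    using A by simp
  have "(\<integral>\<^sup>+j. ennreal (?f j) \<partial>count_space UNIV) = (\<Sum>j\<in>?A. ennreal (?f j))"
    using A by (intro nn_integral_count_space') (auto simp: subset_eq)
  also have "\<dots> = ennreal (\<Sum>j\<in>?A. ?f j)"
    using nonneg pos by (intro sum_ennreal) auto
  also have "(\<Sum>j\<in>?A. ?f j) = (\<Sum>j\<in>?A. q i j) / exit_rate q i"
    unfolding sum_divide_distrib by (intro sum.cong) auto
  also have "\<dots> = 1" using ex pos by simp
  finally show ?thesis
    unfolding jump_pmf_def using nonneg pos by (subst pmf_embed_pmf) auto
qed

lemma prob_space_stay:
  assumes "0 < exit_rate q i"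
  shows "prob_space (stay q i)"
  unfolding stay_def
  by (intro prob_space.prob_space_distr prob_space_exponential_density assms) simp

lemma sets_stay [simp]: "sets (stay q i) = sets step_space"
  by (simp add: stay_def)

lemma measurable_stay:
  assumes "\<And>i. 0 < exit_rate q i"
  shows "stay q \<in> measurable (count_space UNIV) (subprob_algebra step_space)"
  using assms
  by (auto simp: space_subprob_algebra prob_space_stay prob_space_imp_subprob_space)

lemma Ionescu_Tulcea_path_kernel:
  fixes q :: "'s \<Rightarrow> 's \<Rightarrow> real"
  assumes pos: "\<And>i. 0 < exit_rate q i"
  shows "Ionescu_Tulcea (path_kernel q i) (\<lambda>_. step_space)"
proof -
  note stay = measurable_stay[OF pos]
  have bind: "prob_space (measure_pmf p \<bind> stay q)"
    "sets (measure_pmf p \<bind> stay q) = sets step_space" for p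
  proof -
    have st: "stay q \<in> measurable (measure_pmf p) (subprob_algebra step_space)"
      using stay by (simp cong: measurable_cong_sets)
    show "prob_space (measure_pmf p \<bind> stay q)"
      by (rule measure_pmf.prob_space_bind[OF _ st]) (simp add: prob_space_stay pos)
    show "sets (measure_pmf p \<bind> stay q) = sets step_space"
      by (rule sets_bind) auto
  qed
  have meas: "path_kernel q i n
      \<in> measurable (PiM {0..<n} (\<lambda>_. step_space)) (subprob_algebra step_space)" for n
  proof (cases n)
    case 0
    have "path_kernel q i 0 = (\<lambda>_. stay q i)" by (rule ext) simp
    with 0 show ?thesis
      by (simp add: space_subprob_algebra prob_space_stay pos prob_space_imp_subprob_space)
  next
    case (Suc m)
    have "(\<lambda>s. measure_pmf (jump_pmf q s) \<bind> stay q)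
        \<in> measurable (count_space UNIV) (subprob_algebra step_space)"
      using bind by (auto simp: space_subprob_algebra prob_space_imp_subprob_space)
    moreover have "(\<lambda>\<omega>. fst (\<omega> m)) \<in> measurable (PiM {0..<n} (\<lambda>_. step_space)) (count_space UNIV)"
      using Suc by (intro measurable_compose[where f="\<lambda>\<omega>. \<omega> m" and g=fst,
          OF measurable_component_singleton[where M="\<lambda>_. step_space"] measurable_fst]) auto
    ultimately have "(\<lambda>\<omega>. measure_pmf (jump_pmf q (fst (\<omega> m))) \<bind> stay q)
        \<in> measurable (PiM {0..<n} (\<lambda>_. step_space)) (subprob_algebra step_space)"
      by (rule measurable_compose[rotated])
    moreover have "path_kernel q i n = (\<lambda>\<omega>. measure_pmf (jump_pmf q (fst (\<omega> m))) \<bind> stay q)"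
      by (rule ext) (simp add: Suc)
    ultimately show ?thesis by simp
  qed
  have "prob_space (path_kernel q i n \<omega>)" for n \<omega>
    by (cases n) (simp_all add: prob_space_stay pos bind)
  with meas show ?thesis
    by (intro Ionescu_Tulcea.intro)
qed


lemma prob_space_path_law:
  fixes q :: "'s \<Rightarrow> 's \<Rightarrow> real"
  assumes pos: "\<And>i. 0 < exit_rate q i"
  shows "prob_space (path_law q i)"
proof -
  interpret IT: Ionescu_Tulcea "path_kernel q i" "\<lambda>_. step_space"
    by (rule Ionescu_Tulcea_path_kernel[OF pos])
  let ?E = "PiM {} (\<lambda>_. step_space) :: (nat \<Rightarrow> 's \<times> real) measure"
  have "emeasure IT.PF.lim (IT.PF.emb UNIV {} (space ?E)) = emeasure (IT.CI {}) (space ?E)"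
    by (rule IT.lim) (rule finite.emptyI sets.top)+
  also have "space ?E = space (IT.CI {})"
    unfolding IT.CI_def by (simp only: space_distr)
  also have "emeasure (IT.CI {}) (space (IT.CI {})) = 1"
    by (rule prob_space.emeasure_space_1[OF IT.PF.prob_space_P[OF finite.emptyI subset_UNIV]])
  finally have "emeasure IT.PF.lim (IT.PF.emb UNIV {} (space (IT.CI {}))) = 1" .
  moreover have "IT.PF.emb UNIV {} (space (IT.CI {})) = space IT.PF.lim"
    unfolding IT.CI_def IT.PF.space_lim by (auto simp: prod_emb_def space_PiM restrict_def)
  ultimately have "prob_space IT.PF.lim"
    by (intro prob_spaceI) (simp only:)
  then show ?thesis
    by (simp only: path_law_def)
qed


section \<open>The linear network\<close>

text \<open>
  The minimum is \<open>0\<close> when its denominator is \<open>0\<close>: for \<open>x \<ge> 0\<close> this happens only if both summands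
  vanish, and \<open>min 0 (0 / 0) = 0\<close> since \<open>y / 0 = 0\<close>.
\<close>

fun \<theta>\<^sub>0 :: "(nat \<Rightarrow> real) \<Rightarrow> nat \<Rightarrow> real" where
  "\<theta>\<^sub>0 x 0 = x 0"
| "\<theta>\<^sub>0 x (Suc k) = min (\<theta>\<^sub>0 x k) (\<theta>\<^sub>0 x k / (\<theta>\<^sub>0 x k + x (Suc k)))"

definition \<psi> :: "nat \<Rightarrow> nat \<Rightarrow> (nat \<Rightarrow> real) \<Rightarrow> real" where
  "\<psi> L k x =
     (if k = 0 then \<theta>\<^sub>0 x L else min (x k) (x k / (\<theta>\<^sub>0 x (k - 1) + x k)))"

definition \<phi> :: "nat \<Rightarrow> (nat \<Rightarrow> real) \<Rightarrow> nat \<Rightarrow> (nat \<Rightarrow> nat) \<Rightarrow> real" where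
  "\<phi> L a k n = \<psi> L k (\<lambda>j. a j * real (n j))"

text \<open>The set \<open>\<nat>\<^bsup>L+1\<^esup>\<close>, with coordinates \<open>0, \<dots>, L\<close>; the other coordinates are set to \<open>0\<close>.\<close>

definition states :: "nat \<Rightarrow> (nat \<Rightarrow> nat) set" where
  "states L = {n. \<forall>k>L. n k = 0}"

definition network_rate ::
  "nat \<Rightarrow> (nat \<Rightarrow> real) \<Rightarrow> (nat \<Rightarrow> real) \<Rightarrow> (nat \<Rightarrow> real) \<Rightarrow> (nat \<Rightarrow> nat) \<Rightarrow> (nat \<Rightarrow> nat) \<Rightarrow> real" where
  "network_rate L lam mu a n m =
     (\<Sum>k\<le>L. (if m = n(k := n k + 1) then lam k else 0)
            + (if 0 < n k \<and> m = n(k := n k - 1) then mu k * \<phi> L a k n else 0))"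

lemma \<theta>\<^sub>0_nonneg: "(\<And>k. 0 \<le> x k) \<Longrightarrow> 0 \<le> \<theta>\<^sub>0 x k"
  by (induction k) auto

lemma \<psi>_nonneg: "(\<And>k. 0 \<le> x k) \<Longrightarrow> 0 \<le> \<psi> L k x"
  by (simp add: \<psi>_def \<theta>\<^sub>0_nonneg)

text \<open>
  Coordinates beyond \<open>L\<close> never enter \<open>\<phi>\<close>, so it suffices that \<open>a\<close> is nonnegative on \<open>{..L}\<close>.
\<close>

lemma \<theta>\<^sub>0_cong: "(\<And>j. j \<le> k \<Longrightarrow> x j = y j) \<Longrightarrow> \<theta>\<^sub>0 x k = \<theta>\<^sub>0 y k"
  by (induction k) auto

lemma \<phi>_nonneg:
  assumes "\<And>j. j \<le> L \<Longrightarrow> 0 \<le> a j" "k \<le> L"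
  shows "0 \<le> \<phi> L a k n"
proof -
  let ?x = "\<lambda>j. a j * real (n j)" and ?y = "\<lambda>j. if j \<le> L then a j * real (n j) else 0"
  have eq: "\<theta>\<^sub>0 ?x j = \<theta>\<^sub>0 ?y j" if "j \<le> L" for j
    using that by (intro \<theta>\<^sub>0_cong) auto
  have "\<phi> L a k n = \<psi> L k ?y"
    using assms(2) eq[of L] eq[of "k - 1"] by (simp add: \<phi>_def \<psi>_def)
  also have "0 \<le> \<dots>" using assms(1) by (intro \<psi>_nonneg) auto
  finally show ?thesis .
qed

lemma network_rate_nonneg:
  assumes "\<And>k. k \<le> L \<Longrightarrow> 0 \<le> lam k" "\<And>k. k \<le> L \<Longrightarrow> 0 \<le> mu k" "\<And>k. k \<le> L \<Longrightarrow> 0 \<le> a k"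
  shows "0 \<le> network_rate L lam mu a n m"
  unfolding network_rate_def using assms
  by (intro sum_nonneg add_nonneg_nonneg) (auto intro!: mult_nonneg_nonneg \<phi>_nonneg)

lemma finite_network_rate: "finite {m. network_rate L lam mu a n m \<noteq> 0}"
proof (rule finite_subset)
  let ?B = "(\<lambda>k. n(k := n k + 1)) ` {..L} \<union> (\<lambda>k. n(k := n k - 1)) ` {..L}"
  have "network_rate L lam mu a n m = 0" if "m \<notin> ?B" for m
    unfolding network_rate_def using that by (intro sum.neutral ballI) (simp add: image_iff)
  then show "{m. network_rate L lam mu a n m \<noteq> 0} \<subseteq> ?B" by blast
qed simp

lemma exit_rate_network:
  "exit_rate (network_rate L lam mu a) n =
     (\<Sum>k\<le>L. lam k + (if 0 < n k then mu k * \<phi> L a k n else 0))"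
proof -
  let ?q = "network_rate L lam mu a"
  let ?B = "(\<lambda>k. n(k := n k + 1)) ` {..L} \<union> (\<lambda>k. n(k := n k - 1)) ` {k. k \<le> L \<and> 0 < n k}"
  have up: "n(k := n k + 1) \<noteq> n" for k
    by (metis fun_upd_same n_not_Suc_n Suc_eq_plus1)
  have down: "n(k := n k - 1) \<noteq> n" if "0 < n k" for k
    using that by (metis fun_upd_same diff_less less_irrefl zero_less_one)
  have B: "finite ?B" by simp
  have zero: "?q n m = 0" if "m \<notin> ?B" for m
    unfolding network_rate_def using that by (intro sum.neutral ballI) (auto simp: image_iff)
  have nB: "n \<notin> ?B" using up[symmetric] down[symmetric] by blast
  have "exit_rate ?q n = infsum (?q n) ?B"
    unfolding exit_rate_def
  proof (rule infsum_cong_neutral)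
    show "?q n m = 0" if "m \<in> ?B - -{n}" for m
    proof -
      from that have "m \<in> ?B" by (rule DiffD1)
      moreover from that have "m = n" by simp
      ultimately show ?thesis using nB by (simp only: simp_thms)
    qed
    show "?q n m = 0" if "m \<in> -{n} - ?B" for m using that by (intro zero) blast
  qed simp
  also have "\<dots> = (\<Sum>m\<in>?B. ?q n m)"
    by (rule infsum_finite[OF B])
  also have "\<dots> = (\<Sum>k\<le>L. \<Sum>m\<in>?B. (if m = n(k := n k + 1) then lam k else 0)
            + (if 0 < n k \<and> m = n(k := n k - 1) then mu k * \<phi> L a k n else 0))"
    unfolding network_rate_def by (rule sum.swap)
  also have "\<dots> = (\<Sum>k\<le>L. lam k + (if 0 < n k then mu k * \<phi> L a k n else 0))"
  proof (rule sum.cong[OF refl])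
    fix k assume k: "k \<in> {..L}"
    have delta: "(\<Sum>m\<in>?B. if m = b then c else 0) = c" if "b \<in> ?B" for b and c :: real
      using that by (simp only: sum.delta[OF B] if_True)
    have "(\<Sum>m\<in>?B. if m = n(k := n k + 1) then lam k else 0) = lam k"
      using k by (intro delta) blast
    moreover have "(\<Sum>m\<in>?B. if 0 < n k \<and> m = n(k := n k - 1) then mu k * \<phi> L a k n else 0)
        = (if 0 < n k then mu k * \<phi> L a k n else 0)"
    proof (cases "0 < n k")
      case True
      then have "n(k := n k - 1) \<in> ?B" using k by blast
      then show ?thesis using True by (simp only: simp_thms if_True delta)
    qed simp
    ultimately show "(\<Sum>m\<in>?B. (if m = n(k := n k + 1) then lam k else 0)
            + (if 0 < n k \<and> m = n(k := n k - 1) then mu k * \<phi> L a k n else 0))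
        = lam k + (if 0 < n k then mu k * \<phi> L a k n else 0)"
      by (simp only: sum.distrib)
  qed
  finally show ?thesis .
qed

lemma exit_rate_network_pos:
  assumes "\<And>k. k \<le> L \<Longrightarrow> 0 < lam k" "\<And>k. k \<le> L \<Longrightarrow> 0 < mu k" "\<And>k. k \<le> L \<Longrightarrow> 0 < a k"
  shows "0 < exit_rate (network_rate L lam mu a) n"
  unfolding exit_rate_network using assms
  by (intro sum_pos add_pos_nonneg) (auto intro!: mult_nonneg_nonneg \<phi>_nonneg simp: less_imp_le)

lemma Ionescu_Tulcea_network:
  assumes "\<And>k. k \<le> L \<Longrightarrow> 0 < lam k" "\<And>k. k \<le> L \<Longrightarrow> 0 < mu k" "\<And>k. k \<le> L \<Longrightarrow> 0 < a k"
  shows "Ionescu_Tulcea (path_kernel (network_rate L lam mu a) i) (\<lambda>_. step_space)"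
  by (intro Ionescu_Tulcea_path_kernel exit_rate_network_pos assms)

end

theory Submission
  imports Defs
begin

text \<open>
  The proof is by a Foster-Lyapunov function. Write \<open>x\<^sub>k = a\<^sub>k n\<^sub>k\<close> for the loads and \<open>\<rho>\<^sub>k = \<lambda>\<^sub>k / \<mu>\<^sub>k\<close>. Since
  \<open>\<theta>\<^sub>0\<^sup>k = min (\<theta>\<^sub>0\<^sup>k\<^sup>-\<^sup>1) (1 - \<phi>\<^sub>k)\<close>, class 0 is served at the smallest of \<open>x\<^sub>0\<close> and the rates \<open>1 - \<phi>\<^sub>k\<close>. If each
  other class were served at its own intensity \<open>\<rho>\<^sub>k\<close>, the load condition would leave more than \<open>\<rho>\<^sub>0\<close>
  for class 0. The difficulty is that \<open>\<phi>\<^sub>k\<close> fluctuates, and the minimum of fluctuating rates may have a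
  mean below the minimum of the means. Small access rates remove the fluctuations: \<open>x\<^sub>k\<close> then moves in
  small steps \<open>a\<^sub>k\<close> and stays close to an equilibrium.

  Two scales have to be combined. When the classes 0 and 1 are large, the rate \<open>u = x\<^sub>0 / (x\<^sub>0 + x\<^sub>1)\<close> at
  which class 0 passes link 1 is nearly constant in time, while the loads on the links \<open>2, \<dots>, L\<close> relax
  to equilibria determined by \<open>u\<close>. Relaxation happens along the cascade: the inflow of a link settles
  once the previous links have settled. The corrector \<open>\<Phi>\<close>, a weighted sum of smoothed distances
  \<open>\<bar>x\<^sub>k - target u k\<bar>\<close>, has for frozen \<open>u\<close> a drift of at most \<open>\<eta> - \<bar>\<theta>\<^sub>0\<^sup>L - ideal u L\<bar>\<close>
  (lemma \<open>cascade\<close>). Each distance is divided by \<open>a\<^sub>k \<mu>\<^sub>k\<close>, so access rates of very different size do no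
  harm. Adding the corrector to a function of \<open>x\<^sub>0\<close> and \<open>x\<^sub>1\<close> replaces the actual rate of class 0 by its
  equilibrium value in the drift.

  For the classes 0 and 1 the function \<open>x\<^sub>0\<^sup>p\<^sup>+\<^sup>1 + c x\<^sub>1\<^sup>p\<^sup>+\<^sup>1\<close>, suitably normalised, works if \<open>p\<close> is large
  (lemma \<open>planar_weights_negative\<close>): a high power switches between the two classes, counting class 1 only
  if it takes more than its share \<open>\<rho>\<^sub>1\<close> of link 1. Multiplying the corrector by \<open>(x\<^sub>0 + x\<^sub>1)\<^sup>p\<close> gives it the
  matching order, and powers of the remaining loads absorb what is left, because a large queue on a
  link \<open>k \<ge> 2\<close> drains by itself.

  This gives drift below \<open>-1\<close> outside a finite set of states (lemma \<open>drift_bound\<close>). From there to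
  positive recurrence of each state, \<open>ergodic_if_drift\<close> adds a bounded function that uses a uniform form
  of irreducibility, and \<open>foster_lyapunov\<close> evaluates the return time on the path space.
\<close>

section \<open>Integrals over the path law\<close>

text \<open>
  Expectations under the path law reduce to finitely many coordinates. The two lemmas below say this
  for an arbitrary Ionescu-Tulcea measure, the second one integrating out the last coordinate with
  its kernel.
\<close>

lemma (in Ionescu_Tulcea) nn_integral_lim:
  assumes f[measurable]: "f \<in> borel_measurable (PiM {0..<n} M)"
  shows "(\<integral>\<^sup>+\<omega>. f (restrict \<omega> {0..<n}) \<partial>PF.lim) = (\<integral>\<^sup>+\<omega>. f \<omega> \<partial>C 0 n (\<lambda>_. undefined))"
proof -
  let ?J = "{0..<n}"
  have up: "up_to ?J = n"
    by (intro antisym) (simp_all add: up_to_iff_Ico, metis up_to ivl_subset finite_atLeastLessThan le_zero_eq not_le less_imp_le)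
  have m1: "(\<lambda>\<omega>. restrict \<omega> ?J) \<in> measurable PF.lim (PiM ?J M)"
    by (simp add: measurable_cong_sets[OF PF.sets_lim refl])
  have m2: "(\<lambda>\<omega>. restrict \<omega> ?J) \<in> measurable (C 0 n (\<lambda>_. undefined)) (PiM ?J M)"
    using measurable_restrict_subset[of ?J ?J M]
    by (simp add: measurable_cong_sets[OF sets_C refl])
  have "(\<integral>\<^sup>+\<omega>. f (restrict \<omega> ?J) \<partial>PF.lim) = (\<integral>\<^sup>+\<omega>. f \<omega> \<partial>CI ?J)"
    by (subst distr_lim[symmetric]) (simp_all add: nn_integral_distr[OF m1])
  also have "\<dots> = (\<integral>\<^sup>+\<omega>. f (restrict \<omega> ?J) \<partial>C 0 n (\<lambda>_. undefined))"
    unfolding CI_def up by (simp add: nn_integral_distr[OF m2])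
  also have "\<dots> = (\<integral>\<^sup>+\<omega>. f \<omega> \<partial>C 0 n (\<lambda>_. undefined))"
    by (intro nn_integral_cong arg_cong[where f=f])
       (auto simp: space_C space_PiM PiE_restrict)
  finally show ?thesis .
qed

lemma (in Ionescu_Tulcea) nn_integral_lim_Suc:
  assumes f[measurable]: "f \<in> borel_measurable (PiM {0..<Suc n} M)"
  shows "(\<integral>\<^sup>+\<omega>. f (restrict \<omega> {0..<Suc n}) \<partial>PF.lim) =
    (\<integral>\<^sup>+\<omega>. (\<integral>\<^sup>+y. f ((restrict \<omega> {0..<n})(n := y)) \<partial>P n (restrict \<omega> {0..<n})) \<partial>PF.lim)"
proof -
  let ?u = "\<lambda>_::nat. undefined :: 'a"
  have u: "?u \<in> space (PiM {0..<0} M)" by simp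
  have e: "eP n \<in> measurable (C 0 n ?u) (subprob_algebra (PiM {0..<Suc n} M))"
    using measurable_eP[of n] by (simp add: measurable_cong_sets[OF sets_C refl])
  have "(\<integral>\<^sup>+\<omega>. f (restrict \<omega> {0..<Suc n}) \<partial>PF.lim) = (\<integral>\<^sup>+\<omega>. f \<omega> \<partial>(C 0 n ?u \<bind> eP n))"
    by (subst nn_integral_lim[OF f]) simp
  also have "\<dots> = (\<integral>\<^sup>+\<omega>. (\<integral>\<^sup>+x. f x \<partial>eP n \<omega>) \<partial>C 0 n ?u)"
    by (rule nn_integral_bind[OF f e])
  also have "\<dots> = (\<integral>\<^sup>+\<omega>. (\<integral>\<^sup>+x. f x \<partial>eP n (restrict \<omega> {0..<n})) \<partial>PF.lim)"
    by (subst nn_integral_lim) (auto intro!: nn_integral_measurable_subprob_algebra2 simp: measurable_split_conv)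
  also have "\<dots> = (\<integral>\<^sup>+\<omega>. (\<integral>\<^sup>+y. f ((restrict \<omega> {0..<n})(n := y)) \<partial>P n (restrict \<omega> {0..<n})) \<partial>PF.lim)"
    by (intro nn_integral_cong nn_integral_eP f) (auto simp: PF.space_lim space_PiM)
  finally show ?thesis .
qed


lemma measurable_stepI:
  assumes "m \<in> I" and "f \<in> measurable step_space N"
  shows "(\<lambda>\<omega>. f (\<omega> m)) \<in> measurable (PiM I (\<lambda>_. step_space)) N"
  by (rule measurable_compose[OF measurable_component_singleton[where M="\<lambda>_. step_space"] assms(2)]) fact

lemma sets_path_law:
  fixes q :: "'s \<Rightarrow> 's \<Rightarrow> real"
  assumes pos: "\<And>i. 0 < exit_rate q i"
  shows "sets (path_law q i) = sets (PiM UNIV (\<lambda>_. step_space))"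
proof -
  interpret IT: Ionescu_Tulcea "path_kernel q i" "\<lambda>_. step_space"
    by (rule Ionescu_Tulcea_path_kernel[OF pos])
  show ?thesis unfolding path_law_def by (rule IT.PF.sets_lim)
qed

lemma measurable_path_law_step:
  fixes q :: "'s \<Rightarrow> 's \<Rightarrow> real"
  assumes pos: "\<And>i. 0 < exit_rate q i" and f: "f \<in> measurable step_space N"
  shows "(\<lambda>\<omega>. f (\<omega> m)) \<in> measurable (path_law q i) N"
  using measurable_compose[OF measurable_component_singleton[where M="\<lambda>_. step_space" and I=UNIV and i=m] f]
  by (simp add: measurable_cong_sets[OF sets_path_law[OF pos] refl])

lemma nn_integral_path_law_0:
  fixes q :: "'s \<Rightarrow> 's \<Rightarrow> real"
  assumes pos: "\<And>i. 0 < exit_rate q i" and f: "(f :: _ \<Rightarrow> ennreal) \<in> borel_measurable step_space"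
  shows "(\<integral>\<^sup>+\<omega>. f (\<omega> 0) \<partial>path_law q i) = (\<integral>\<^sup>+y. f y \<partial>stay q i)"
proof -
  interpret IT: Ionescu_Tulcea "path_kernel q i" "\<lambda>_. step_space"
    by (rule Ionescu_Tulcea_path_kernel[OF pos])
  have "(\<lambda>\<omega>. f (\<omega> 0)) \<in> borel_measurable (PiM {0..<Suc 0} (\<lambda>_. step_space))"
    by (rule measurable_stepI[OF _ f]) simp
  moreover have "emeasure IT.PF.lim (space (PiM UNIV (\<lambda>_. step_space))) = 1"
    using prob_space.emeasure_space_1[OF prob_space_path_law[where i=i, OF pos]]
    unfolding path_law_def IT.PF.space_lim .
  ultimately show ?thesis
    unfolding path_law_def using IT.nn_integral_lim_Suc[of "\<lambda>\<omega>. f (\<omega> 0)" 0] by (simp add: restrict_def)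
qed

text \<open>
  The Markov property in the form used below: a factor that depends on entry \<open>m + 1\<close> only may be
  replaced by its conditional expectation, a jump from the state of entry \<open>m\<close> followed by a holding
  time in the new state.
\<close>

lemma nn_integral_path_law_Suc:
  fixes q :: "'s \<Rightarrow> 's \<Rightarrow> real"
  assumes pos: "\<And>i. 0 < exit_rate q i"
    and g: "g \<in> borel_measurable (PiM {0..<Suc m} (\<lambda>_. step_space))"
    and f: "(f :: _ \<Rightarrow> ennreal) \<in> borel_measurable step_space"
  shows "(\<integral>\<^sup>+\<omega>. g (restrict \<omega> {0..<Suc m}) * f (\<omega> (Suc m)) \<partial>path_law q i) =
    (\<integral>\<^sup>+\<omega>. g (restrict \<omega> {0..<Suc m}) *
       (\<integral>\<^sup>+j. (\<integral>\<^sup>+y. f y \<partial>stay q j) \<partial>jump_pmf q (fst (\<omega> m))) \<partial>path_law q i)"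
proof -
  interpret IT: Ionescu_Tulcea "path_kernel q i" "\<lambda>_. step_space"
    by (rule Ionescu_Tulcea_path_kernel[OF pos])
  let ?h = "\<lambda>\<omega>. g (restrict \<omega> {0..<Suc m}) * f (\<omega> (Suc m))"
  have st: "stay q \<in> measurable (measure_pmf p) (subprob_algebra step_space)" for p
    using measurable_stay[OF pos] by (simp cong: measurable_cong_sets)
  have h: "?h \<in> borel_measurable (PiM {0..<Suc (Suc m)} (\<lambda>_. step_space))"
    by (intro borel_measurable_times_ennreal measurable_compose[OF measurable_restrict_subset g]
          measurable_stepI[OF _ f]) auto
  have inner: "(\<integral>\<^sup>+y. ?h ((restrict \<omega> {0..<Suc m})(Suc m := y)) \<partial>path_kernel q i (Suc m) (restrict \<omega> {0..<Suc m}))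
     = g (restrict \<omega> {0..<Suc m}) * (\<integral>\<^sup>+j. (\<integral>\<^sup>+y. f y \<partial>stay q j) \<partial>jump_pmf q (fst (\<omega> m)))" for \<omega>
  proof -
    have r: "restrict ((restrict \<omega> {0..<Suc m})(Suc m := y)) {0..<Suc m} = restrict \<omega> {0..<Suc m}" for y
      by (auto simp: restrict_def fun_eq_iff)
    have f': "f \<in> borel_measurable (measure_pmf p \<bind> stay q)" for p
      using f by (simp add: measurable_cong_sets[OF sets_bind[where N=step_space] refl])
    have "(\<integral>\<^sup>+y. ?h ((restrict \<omega> {0..<Suc m})(Suc m := y)) \<partial>path_kernel q i (Suc m) (restrict \<omega> {0..<Suc m}))
      = g (restrict \<omega> {0..<Suc m}) * (\<integral>\<^sup>+y. f y \<partial>(measure_pmf (jump_pmf q (fst (\<omega> m))) \<bind> stay q))"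
      unfolding r by (simp add: nn_integral_cmult f')
    also have "(\<integral>\<^sup>+y. f y \<partial>(measure_pmf (jump_pmf q (fst (\<omega> m))) \<bind> stay q)) =
       (\<integral>\<^sup>+j. (\<integral>\<^sup>+y. f y \<partial>stay q j) \<partial>jump_pmf q (fst (\<omega> m)))"
      by (rule nn_integral_bind[OF f st])
    finally show ?thesis .
  qed
  have e: "?h \<omega> = ?h (restrict \<omega> {0..<Suc (Suc m)})" for \<omega>
    by (simp add: restrict_restrict)
  have "(\<integral>\<^sup>+\<omega>. ?h \<omega> \<partial>path_law q i) = (\<integral>\<^sup>+\<omega>. ?h (restrict \<omega> {0..<Suc (Suc m)}) \<partial>path_law q i)"
    by (subst e) (rule refl)
  also have "\<dots> = (\<integral>\<^sup>+\<omega>. (\<integral>\<^sup>+y. ?h ((restrict \<omega> {0..<Suc m})(Suc m := y))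
        \<partial>path_kernel q i (Suc m) (restrict \<omega> {0..<Suc m})) \<partial>path_law q i)"
    unfolding path_law_def by (rule IT.nn_integral_lim_Suc[OF h])
  also have "\<dots> = (\<integral>\<^sup>+\<omega>. g (restrict \<omega> {0..<Suc m}) *
       (\<integral>\<^sup>+j. (\<integral>\<^sup>+y. f y \<partial>stay q j) \<partial>jump_pmf q (fst (\<omega> m))) \<partial>path_law q i)"
    unfolding inner ..
  finally show ?thesis .
qed

lemma nn_integral_stay:
  assumes f: "(f :: _ \<Rightarrow> ennreal) \<in> borel_measurable step_space"
  shows "(\<integral>\<^sup>+y. f y \<partial>stay q i) =
    (\<integral>\<^sup>+s. ennreal (exponential_density (exit_rate q i) s) * f (i, s) \<partial>lborel)"
  unfolding stay_def using f by (simp add: nn_integral_distr nn_integral_density)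

lemma nn_integral_stay_fst:
  assumes pos: "0 < exit_rate q i"
  shows "(\<integral>\<^sup>+y. f (fst y) \<partial>stay q i) = f i"
proof -
  have "(\<integral>\<^sup>+y. f (fst y) \<partial>stay q i) = (\<integral>\<^sup>+s. f i \<partial>density lborel (exponential_density (exit_rate q i)))"
    unfolding stay_def by (subst nn_integral_distr) (auto intro!: measurable_compose[OF measurable_fst])
  also have "\<dots> = f i"
    using prob_space.emeasure_space_1[OF prob_space_exponential_density[OF pos]] by simp
  finally show ?thesis .
qed

lemma nn_integral_stay_time:
  assumes pos: "0 < exit_rate q i"
  shows "(\<integral>\<^sup>+y. c (fst y) * ennreal (snd y) \<partial>stay q i) = c i * ennreal (1 / exit_rate q i)"
proof -
  let ?l = "exit_rate q i"
  have m: "(\<lambda>y. c (fst y) * ennreal (snd y)) \<in> borel_measurable step_space"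
    by (intro borel_measurable_times_ennreal measurable_compose[OF measurable_fst] measurable_compose[OF measurable_snd]) auto
  have "(\<integral>\<^sup>+y. c (fst y) * ennreal (snd y) \<partial>stay q i)
    = (\<integral>\<^sup>+s. c i * (ennreal (exponential_density ?l s) * ennreal (s^1)) \<partial>lborel)"
    by (subst nn_integral_stay[OF m]) (simp add: ac_simps)
  also have "\<dots> = c i * (\<integral>\<^sup>+s. ennreal (exponential_density ?l s) * ennreal (s^1) \<partial>lborel)"
    by (rule nn_integral_cmult) simp
  also have "(\<integral>\<^sup>+s. ennreal (exponential_density ?l s) * ennreal (s^1) \<partial>lborel) =
     (\<integral>\<^sup>+s. ennreal (erlang_density 0 ?l s * s^1) \<partial>lborel)"
    using pos by (intro nn_integral_cong) (auto simp: exponential_density_def ennreal_mult' erlang_density_def)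
  also have "\<dots> = ennreal (1 / ?l)"
    using pos by (subst nn_integral_erlang_ith_moment) auto
  finally show ?thesis .
qed

text \<open>
  Positive holding times make the jump times strictly increasing, so that \<open>state_at\<close> at the \<open>n\<close>-th
  jump time is the \<open>n\<close>-th state of the jump chain and not a later one.
\<close>

lemma AE_path_law_pos:
  fixes q :: "'s \<Rightarrow> 's \<Rightarrow> real"
  assumes pos: "\<And>i. 0 < exit_rate q i"
  shows "AE \<omega> in path_law q i. \<forall>m. 0 < snd (\<omega> m)"
  unfolding AE_all_countable
proof
  fix m
  define f :: "'s \<times> real \<Rightarrow> ennreal" where "f y = indicator {..0} (snd y)" for y
  have f: "f \<in> borel_measurable step_space"
    unfolding f_def[abs_def] by (intro measurable_compose[OF measurable_snd]) auto
  have z: "(\<integral>\<^sup>+y. f y \<partial>stay q j) = 0" for j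
  proof -
    have "(\<integral>\<^sup>+y. f y \<partial>stay q j) = (\<integral>\<^sup>+s. ennreal (exponential_density (exit_rate q j) s) * indicator {..0} s \<partial>lborel)"
      by (subst nn_integral_stay[OF f]) (simp add: f_def)
    also have "\<dots> = (\<integral>\<^sup>+(s::real). 0 \<partial>lborel)"
    proof (rule nn_integral_cong_AE)
      show "AE s in lborel. ennreal (exponential_density (exit_rate q j) s) * indicator {..0} s = 0"
        using AE_lborel_singleton[of "0::real"]
        by eventually_elim (auto simp: exponential_density_def erlang_density_def split: split_indicator)
    qed
    finally show ?thesis by simp
  qed
  have "(\<integral>\<^sup>+\<omega>. f (\<omega> m) \<partial>path_law q i) = 0"
  proof (cases m)
    case 0 then show ?thesis by (simp add: nn_integral_path_law_0[OF pos f] z)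
  next
    case (Suc l)
    have "(\<integral>\<^sup>+\<omega>. f (\<omega> m) \<partial>path_law q i) = (\<integral>\<^sup>+\<omega>. 1 * f (\<omega> (Suc l)) \<partial>path_law q i)"
      using Suc by simp
    also have "\<dots> = 0"
      by (subst nn_integral_path_law_Suc[OF pos _ f, where g="\<lambda>_. 1"]) (simp_all add: z)
    finally show ?thesis .
  qed
  then have "AE \<omega> in path_law q i. f (\<omega> m) = 0"
    by (subst (asm) nn_integral_0_iff_AE) (auto intro: measurable_path_law_step[OF pos f])
  then show "AE \<omega> in path_law q i. 0 < snd (\<omega> m)"
    by eventually_elim (auto simp: f_def not_le split: split_indicator_asm)
qed



section \<open>Foster's criterion for jump processes\<close>

lemma state_at_jump_time:
  assumes pos: "\<And>m. 0 < snd (\<omega> m)"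
  shows "state_at \<omega> (jump_time \<omega> n) = Some (fst (\<omega> n))"
proof -
  have mono: "jump_time \<omega> k < jump_time \<omega> l \<longleftrightarrow> k < l" for k l
    by (rule strict_mono_less) (auto intro!: strict_monoI_Suc simp: jump_time_def pos)
  have "(LEAST k. jump_time \<omega> n < jump_time \<omega> (Suc k)) = n"
    unfolding mono by (rule Least_equality) auto
  then show ?thesis unfolding state_at_def using mono by auto
qed

lemma return_time_le:
  assumes pos: "\<And>m. 0 < snd (\<omega> m)" and n: "1 \<le> n" "fst (\<omega> n) = i"
  shows "return_time i \<omega> \<le> ennreal (jump_time \<omega> n)"
proof -
  have "jump_time \<omega> 1 \<le> jump_time \<omega> n"
    unfolding jump_time_def using n less_imp_le[OF pos] by (intro sum_mono2) auto
  then show ?thesis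
    unfolding return_time_def using state_at_jump_time[of \<omega> n, OF pos] n by (intro Inf_lower) auto
qed

text \<open>
  Foster's criterion. The chain is killed at its return to \<open>i\<close>: \<open>D m\<close> is the indicator that it has not
  returned by jump \<open>m\<close>, \<open>c m\<close> is the mean of \<open>U\<close> after the next jump on that event, and \<open>h m\<close> the mean
  time spent in the \<open>m\<close>-th state on it. The drift condition gives \<open>c (m + 1) + h (m + 1) \<le> c m\<close>, so the
  total mean time before the return telescopes to a finite value. This total bounds the return time
  only on paths that do return. Bounded exit rates take care of the others: every jump
  costs at least \<open>1 / \<Lambda>\<close> on average, so the mean number of jumps before the return is finite as
  well, and almost every path returns.

  Values in \<open>ennreal\<close> allow \<open>U = \<infinity>\<close> outside a closed set of states, where the drift condition is
  then trivial.
\<close>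

theorem foster_lyapunov:
  fixes q :: "'s \<Rightarrow> 's \<Rightarrow> real" and U :: "'s \<Rightarrow> ennreal"
  assumes pos: "\<And>j. 0 < exit_rate q j"
    and bounded: "\<And>j. exit_rate q j \<le> \<Lambda>"
    and zero: "U i = 0"
    and drift: "\<And>j. j \<noteq> i \<Longrightarrow> (\<integral>\<^sup>+k. U k \<partial>jump_pmf q j) + ennreal (1 / exit_rate q j) \<le> U j"
    and fin: "(\<integral>\<^sup>+k. U k \<partial>jump_pmf q i) < \<infinity>"
  shows "positive_recurrent q i"
proof -
  let ?P = "path_law q i"
  let ?PU = "\<lambda>j. \<integral>\<^sup>+k. U k \<partial>jump_pmf q j"
  define I :: "'s \<Rightarrow> ennreal" where "I = indicator (-{i})"
  define D where "D m \<omega> = (\<Prod>l\<in>{1..m}. I (fst (\<omega> l)))" for m and \<omega> :: "nat \<Rightarrow> 's \<times> real"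
  define c where "c m = (\<integral>\<^sup>+\<omega>. D m \<omega> * ?PU (fst (\<omega> m)) \<partial>?P)" for m
  define h where "h m = (\<integral>\<^sup>+\<omega>. D m \<omega> * ennreal (snd (\<omega> m)) \<partial>?P)" for m
  have fst_meas: "(\<lambda>y. f (fst y)) \<in> borel_measurable step_space" for f :: "'s \<Rightarrow> ennreal"
    by (rule measurable_compose[OF measurable_fst]) simp
  have time_meas: "(\<lambda>y. ennreal (snd y)) \<in> borel_measurable (step_space :: ('s \<times> real) measure)"
    by (rule measurable_compose[OF measurable_snd]) simp
  have D_Suc: "D (Suc m) \<omega> = D m \<omega> * I (fst (\<omega> (Suc m)))" for m \<omega>
    by (simp add: D_def)
  have D_restrict: "D m (restrict \<omega> {0..<Suc m}) = D m \<omega>" for m \<omega>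
    unfolding D_def by (intro prod.cong) auto
  have D_meas: "D m \<in> borel_measurable (PiM {0..<Suc m} (\<lambda>_. step_space))" for m
    unfolding D_def by (intro borel_measurable_prod_ennreal measurable_stepI[OF _ fst_meas]) auto
  have step: "(\<integral>\<^sup>+\<omega>. D m \<omega> * f (\<omega> (Suc m)) \<partial>?P) =
      (\<integral>\<^sup>+\<omega>. D m \<omega> * (\<integral>\<^sup>+j. (\<integral>\<^sup>+y. f y \<partial>stay q j) \<partial>jump_pmf q (fst (\<omega> m))) \<partial>?P)"
    if "f \<in> borel_measurable step_space" for f m
    using nn_integral_path_law_Suc[of q "D m" m f i, OF pos D_meas that] by (simp only: D_restrict)
  have path_meas: "(\<lambda>\<omega>. f (\<omega> m)) \<in> borel_measurable ?P"
    if "f \<in> borel_measurable step_space" for f :: "'s \<times> real \<Rightarrow> ennreal" and m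
    by (rule measurable_path_law_step[OF pos that])
  have D_meas': "D m \<in> borel_measurable ?P" for m
    unfolding D_def by (intro borel_measurable_prod_ennreal path_meas[OF fst_meas])

  have c0: "c 0 = ?PU i"
    unfolding c_def D_def
    using nn_integral_path_law_0[where i=i, OF pos fst_meas[of ?PU]] by (simp add: nn_integral_stay_fst[where f="?PU" and i=i, OF pos])
  have h0: "h 0 = ennreal (1 / exit_rate q i)"
    unfolding h_def D_def
    using nn_integral_path_law_0[where i=i, OF pos time_meas] nn_integral_stay_time[OF pos, of i "\<lambda>_. 1"] by simp
  have c_eq: "c m = (\<integral>\<^sup>+\<omega>. D (Suc m) \<omega> * U (fst (\<omega> (Suc m))) \<partial>?P)" for m
  proof -
    have "(\<integral>\<^sup>+\<omega>. D (Suc m) \<omega> * U (fst (\<omega> (Suc m))) \<partial>?P)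
        = (\<integral>\<^sup>+\<omega>. D m \<omega> * U (fst (\<omega> (Suc m))) \<partial>?P)"
      by (intro nn_integral_cong) (auto simp: D_Suc I_def zero split: split_indicator)
    then show ?thesis
      unfolding c_def by (simp add: step[OF fst_meas] nn_integral_stay_fst[OF pos])
  qed
  have h_eq: "h (Suc m) = (\<integral>\<^sup>+\<omega>. D (Suc m) \<omega> * ennreal (1 / exit_rate q (fst (\<omega> (Suc m)))) \<partial>?P)" for m
  proof -
    have "h (Suc m) = (\<integral>\<^sup>+\<omega>. D m \<omega> * (I (fst (\<omega> (Suc m))) * ennreal (snd (\<omega> (Suc m)))) \<partial>?P)"
      unfolding h_def D_Suc by (simp add: ac_simps)
    also have "\<dots> = (\<integral>\<^sup>+\<omega>. D m \<omega> * (\<integral>\<^sup>+j. I j * ennreal (1 / exit_rate q j) \<partial>jump_pmf q (fst (\<omega> m))) \<partial>?P)"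
      by (subst step[OF borel_measurable_times_ennreal[OF fst_meas time_meas]])
         (simp add: nn_integral_stay_time[OF pos])
    also have "\<dots> = (\<integral>\<^sup>+\<omega>. D m \<omega> * (I (fst (\<omega> (Suc m))) * ennreal (1 / exit_rate q (fst (\<omega> (Suc m))))) \<partial>?P)"
      by (subst step[OF fst_meas]) (simp add: nn_integral_stay_fst[where f="\<lambda>j. I j * ennreal (1 / exit_rate q j)", OF pos])
    finally show ?thesis by (simp add: D_Suc ac_simps)
  qed
  have decrease: "c (Suc m) + h (Suc m) \<le> c m" for m
  proof -
    have "c (Suc m) + h (Suc m) =
      (\<integral>\<^sup>+\<omega>. D (Suc m) \<omega> * ?PU (fst (\<omega> (Suc m))) + D (Suc m) \<omega> * ennreal (1 / exit_rate q (fst (\<omega> (Suc m)))) \<partial>?P)"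
      unfolding c_def[of "Suc m"] h_eq
      by (intro nn_integral_add[symmetric] borel_measurable_times_ennreal D_meas' path_meas[OF fst_meas])
    also have "\<dots> \<le> c m"
      unfolding c_eq
    proof (intro nn_integral_mono)
      fix \<omega> :: "nat \<Rightarrow> 's \<times> real"
      let ?j = "fst (\<omega> (Suc m))"
      have "?PU ?j + ennreal (1 / exit_rate q ?j) \<le> U ?j" if "?j \<noteq> i"
        using drift[OF that] .
      then show "D (Suc m) \<omega> * ?PU ?j + D (Suc m) \<omega> * ennreal (1 / exit_rate q ?j) \<le> D (Suc m) \<omega> * U ?j"
        by (cases "?j = i") (auto simp: D_Suc I_def distrib_left[symmetric] intro!: mult_left_mono)
    qed
    finally show ?thesis .
  qed
  have "(\<Sum>m<M. h (Suc m)) + c M \<le> c 0" for M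
  proof (induction M)
    case (Suc M)
    have "(\<Sum>m<Suc M. h (Suc m)) + c (Suc M) = (\<Sum>m<M. h (Suc m)) + (c (Suc M) + h (Suc M))"
      by (simp add: ac_simps)
    also have "\<dots> \<le> (\<Sum>m<M. h (Suc m)) + c M"
      by (intro add_left_mono decrease)
    also note Suc
    finally show ?case .
  qed simp
  then have "(\<Sum>m<M. h (Suc m)) \<le> c 0" for M
    by (meson le_iff_add order_trans)
  then have sum_h: "(\<Sum>m. h (Suc m)) \<le> c 0"
    by (intro suminf_le_const summableI)
  then have "(\<Sum>m. h m) \<le> h 0 + c 0"
    using suminf_offset[of h 1] by (simp add: add_mono)
  moreover have "h 0 + c 0 < \<infinity>"
    using fin by (simp add: h0 c0)
  ultimately have sum_h_fin: "(\<Sum>m. h m) < \<infinity>" by (rule le_less_trans)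

  have \<Lambda>: "0 < \<Lambda>" using pos bounded by (rule less_le_trans)
  have "AE \<omega> in ?P. (\<Sum>m. D (Suc m) \<omega> * ennreal (1 / \<Lambda>)) < \<infinity>"
  proof -
    have "(\<integral>\<^sup>+\<omega>. (\<Sum>m. D (Suc m) \<omega> * ennreal (1 / \<Lambda>)) \<partial>?P) = (\<Sum>m. (\<integral>\<^sup>+\<omega>. D (Suc m) \<omega> * ennreal (1 / \<Lambda>) \<partial>?P))"
      by (intro nn_integral_suminf borel_measurable_times_ennreal D_meas') simp
    also have "\<dots> \<le> (\<Sum>m. h (Suc m))"
      unfolding h_eq using \<Lambda> pos bounded
      by (intro suminf_le summableI nn_integral_mono mult_left_mono ennreal_leI frac_le) auto
    also have "\<dots> < \<infinity>" using sum_h fin c0 by (auto simp: le_less_trans)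
    finally have "(\<integral>\<^sup>+\<omega>. (\<Sum>m. D (Suc m) \<omega> * ennreal (1 / \<Lambda>)) \<partial>?P) \<noteq> \<infinity>" by simp
    then have "AE \<omega> in ?P. (\<Sum>m. D (Suc m) \<omega> * ennreal (1 / \<Lambda>)) \<noteq> \<infinity>"
      by (intro nn_integral_noteq_infinite borel_measurable_suminf_order borel_measurable_times_ennreal
            D_meas' borel_measurable_const)
    then show ?thesis by (simp add: less_top)
  qed
  then have "AE \<omega> in ?P. return_time i \<omega> \<le> (\<Sum>m. D m \<omega> * ennreal (snd (\<omega> m)))"
    using AE_path_law_pos[where i=i, OF pos]
  proof eventually_elim
    fix \<omega> :: "nat \<Rightarrow> 's \<times> real"
    assume sum: "(\<Sum>m. D (Suc m) \<omega> * ennreal (1 / \<Lambda>)) < \<infinity>" and p: "\<forall>m. 0 < snd (\<omega> m)"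
    have "\<exists>n\<ge>1. fst (\<omega> n) = i"
    proof (rule ccontr)
      assume "\<not> (\<exists>n\<ge>1. fst (\<omega> n) = i)"
      then have "D (Suc m) \<omega> = 1" for m by (auto simp: D_def I_def intro!: prod.neutral)
      with sum have "summable (\<lambda>_::nat. 1 / \<Lambda>)"
        using \<Lambda> by (intro summable_suminf_not_top) auto
      with \<Lambda> show False by (simp add: summable_const_iff)
    qed
    then obtain n where n: "1 \<le> n" "fst (\<omega> n) = i" "\<And>l. 1 \<le> l \<Longrightarrow> l < n \<Longrightarrow> fst (\<omega> l) \<noteq> i"
      using exists_least_iff[of "\<lambda>n. 1 \<le> n \<and> fst (\<omega> n) = i"] by auto
    have D1: "D m \<omega> = 1" if "m < n" for m
      using that n(3) by (auto simp: D_def I_def intro!: prod.neutral)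
    have "return_time i \<omega> \<le> ennreal (jump_time \<omega> n)"
      using p n by (intro return_time_le) auto
    also have "\<dots> = (\<Sum>m<n. D m \<omega> * ennreal (snd (\<omega> m)))"
      unfolding jump_time_def using p
      by (subst sum_ennreal[symmetric]) (auto simp: D1 less_imp_le)
    also have "\<dots> \<le> (\<Sum>m. D m \<omega> * ennreal (snd (\<omega> m)))"
      by (intro sum_le_suminf summableI) auto
    finally show "return_time i \<omega> \<le> (\<Sum>m. D m \<omega> * ennreal (snd (\<omega> m)))" .
  qed
  then have "(\<integral>\<^sup>+\<omega>. return_time i \<omega> \<partial>?P) \<le> (\<integral>\<^sup>+\<omega>. (\<Sum>m. D m \<omega> * ennreal (snd (\<omega> m))) \<partial>?P)"
    by (rule nn_integral_mono_AE)
  also have "\<dots> = (\<Sum>m. h m)"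
    unfolding h_def by (intro nn_integral_suminf borel_measurable_times_ennreal D_meas' path_meas[OF time_meas])
  finally show ?thesis
    using sum_h_fin unfolding positive_recurrent_def by (rule le_less_trans)
qed

section \<open>The share of a class on a link\<close>

text \<open>
  The rate that a link gives to a class of load \<open>x\<close> when the competing class arrives at rate \<open>t\<close>. The
  formula with \<open>max\<close> agrees with the minimum in the model and is Lipschitz in both arguments.
\<close>

definition share :: "real \<Rightarrow> real \<Rightarrow> real" where
  "share t x = x / max 1 (t + x)"

lemma divide_max_1_le: "0 \<le> z \<Longrightarrow> z / max 1 s \<le> (z::real)"
  using mult_left_mono[of 1 "max 1 s" z] by (simp add: divide_le_eq)

lemma share_eq_min:
  assumes "0 \<le> t" "0 \<le> x"
  shows "share t x = min x (x / (t + x))"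
proof (cases "1 \<le> t + x")
  case True
  then show ?thesis using divide_max_1_le[of x "t + x"] assms by (simp add: share_def max_def min_def)
next
  case False
  then have "x \<le> x / (t + x) \<or> x = 0"
    using assms by (cases "x = 0") (auto simp: le_divide_eq mult_left_le)
  then show ?thesis using False by (auto simp: share_def max_def min_def)
qed

lemma share_nonneg: "0 \<le> t \<Longrightarrow> 0 \<le> x \<Longrightarrow> 0 \<le> share t x"
  by (simp add: share_def)

lemma share_le_1: "0 \<le> t \<Longrightarrow> 0 \<le> x \<Longrightarrow> share t x \<le> 1"
  by (simp add: share_def field_simps)

lemma share_mono:
  assumes "0 \<le> t" "0 \<le> x" "x \<le> y"
  shows "share t x \<le> share t y"
proof -
  have "x / (t + x) \<le> y / (t + y)"
  proof (cases "t + x = 0")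
    case True
    then show ?thesis using assms by simp
  next
    case False
    then have pos: "0 < t + x" "0 < t + y" using assms by auto
    have "x * (t + y) \<le> y * (t + x)"
      using mult_left_mono[OF assms(3,1)] by (simp add: distrib_left mult.commute)
    with pos show ?thesis by (simp add: divide_le_eq le_divide_eq)
  qed
  then show ?thesis using assms by (auto simp: share_eq_min intro: min.coboundedI1 min.coboundedI2)
qed

lemma share_lipschitz:
  assumes "0 \<le> t" "0 \<le> x" "0 \<le> y"
  shows "\<bar>share t x - share t y\<bar> \<le> \<bar>x - y\<bar>"
proof -
  have *: "share t y - share t x \<le> y - x" if "0 \<le> x" "x \<le> y" for x y
  proof -
    have "y / max 1 (t + y) \<le> y / max 1 (t + x)"
      using that assms by (intro divide_left_mono) auto
    then have "share t y - share t x \<le> (y - x) / max 1 (t + x)"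
      by (simp add: share_def diff_divide_distrib)
    also have "\<dots> \<le> y - x" using that by (intro divide_max_1_le) simp
    finally show ?thesis .
  qed
  show ?thesis
    using *[of x y] *[of y x] share_mono[of t x y] share_mono[of t y x] assms by (cases "x \<le> y") auto
qed

lemma share_lipschitz_upstream:
  assumes "0 \<le> s" "0 \<le> t" "0 \<le> x"
  shows "\<bar>share s x - share t x\<bar> \<le> \<bar>s - t\<bar>"
proof -
  have *: "0 \<le> share s x - share t x \<and> share s x - share t x \<le> t - s" if "0 \<le> s" "s \<le> t" for s t
  proof -
    let ?s = "max 1 (s + x)" and ?t = "max 1 (t + x)"
    have "share s x - share t x = x / ?t * ((?t - ?s) / ?s)"
      by (simp add: share_def field_simps)
    moreover have "x / ?t \<le> 1" "0 \<le> x / ?t" using that assms by (auto simp: field_simps)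
    moreover have "0 \<le> ?t - ?s" "?t - ?s \<le> t - s" using that by auto
    then have "0 \<le> (?t - ?s) / ?s" "(?t - ?s) / ?s \<le> t - s"
      using divide_max_1_le[of "?t - ?s" "s + x"] by auto
    ultimately show ?thesis
      using mult_left_le_one_le[of "(?t - ?s) / ?s" "x / ?t"] mult_nonneg_nonneg[of "x / ?t" "(?t - ?s) / ?s"]
      by linarith
  qed
  show ?thesis using *[of s t] *[of t s] assms by (cases "s \<le> t") auto
qed

text \<open>
  A link with spare capacity passes on all it receives; a saturated one passes on what the local
  class leaves. Hence class 0 suffers from a link only through the rate at which the local class
  is served.
\<close>

lemma \<theta>\<^sub>0_Suc_eq_min:
  assumes "\<And>k. 0 \<le> x k"
  shows "\<theta>\<^sub>0 x (Suc k) = min (\<theta>\<^sub>0 x k) (1 - share (\<theta>\<^sub>0 x k) (x (Suc k)))"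
proof -
  have "0 \<le> \<theta>\<^sub>0 x k" "0 \<le> x (Suc k)" using assms by (auto intro: \<theta>\<^sub>0_nonneg)
  moreover from this have "\<theta>\<^sub>0 x (Suc k) = share (x (Suc k)) (\<theta>\<^sub>0 x k)"
    by (simp add: share_eq_min add.commute)
  ultimately show ?thesis
    using divide_max_1_le[of "\<theta>\<^sub>0 x k" "x (Suc k) + \<theta>\<^sub>0 x k"]
    by (cases "1 \<le> \<theta>\<^sub>0 x k + x (Suc k)") (auto simp: share_def min_def max_def field_simps)
qed

lemma \<theta>\<^sub>0_1_eq_share:
  assumes "\<And>k. 0 \<le> x k"
  shows "\<theta>\<^sub>0 x 1 = share (x 1) (x 0)"
  using assms by (simp add: share_eq_min add.commute)

lemma \<theta>\<^sub>0_le_1: "(\<And>k. 0 \<le> x k) \<Longrightarrow> 1 \<le> k \<Longrightarrow> \<theta>\<^sub>0 x k \<le> 1"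
  using share_nonneg[of "\<theta>\<^sub>0 x (k - 1)" "x k"] \<theta>\<^sub>0_Suc_eq_min[of x "k - 1"] \<theta>\<^sub>0_nonneg[of x "k - 1"]
  by auto

section \<open>The generator of the network\<close>

locale linear_network =
  fixes L :: nat and lam mu a :: "nat \<Rightarrow> real"
  assumes L_ge: "1 \<le> L"
    and lam_pos: "\<And>k. k \<le> L \<Longrightarrow> 0 < lam k"
    and mu_pos: "\<And>k. k \<le> L \<Longrightarrow> 0 < mu k"
    and a_pos: "\<And>k. k \<le> L \<Longrightarrow> 0 < a k"
begin

text \<open>
  The loads. Coordinates beyond \<open>L\<close> are set to \<open>0\<close>, so that \<open>x n\<close> is nonnegative everywhere, as the facts
  on \<open>\<theta>\<^sub>0\<close> require.
\<close>

definition x :: "(nat \<Rightarrow> nat) \<Rightarrow> nat \<Rightarrow> real" where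
  "x n k = (if k \<le> L then a k * real (n k) else 0)"

abbreviation \<theta> :: "(nat \<Rightarrow> nat) \<Rightarrow> nat \<Rightarrow> real" where
  "\<theta> n \<equiv> \<theta>\<^sub>0 (x n)"

lemma x_nonneg [simp]: "0 \<le> x n k"
  using a_pos by (auto simp: x_def less_imp_le)

lemma \<theta>_nonneg [simp]: "0 \<le> \<theta> n k"
  by (simp add: \<theta>\<^sub>0_nonneg)

lemma \<theta>_le_1: "1 \<le> k \<Longrightarrow> \<theta> n k \<le> 1"
  by (simp add: \<theta>\<^sub>0_le_1)

lemma \<phi>_0: "\<phi> L a 0 n = \<theta> n L"
  unfolding \<phi>_def \<psi>_def by (simp add: x_def cong: \<theta>\<^sub>0_cong)

lemma \<phi>_pos_eq: "1 \<le> k \<Longrightarrow> k \<le> L \<Longrightarrow> \<phi> L a k n = share (\<theta> n (k - 1)) (x n k)"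
proof -
  assume k: "1 \<le> k" "k \<le> L"
  have "\<theta>\<^sub>0 (\<lambda>j. a j * real (n j)) (k - 1) = \<theta> n (k - 1)"
    using k by (intro \<theta>\<^sub>0_cong) (auto simp: x_def)
  then show ?thesis using k by (simp add: \<phi>_def \<psi>_def share_eq_min) (simp add: x_def)
qed

lemma \<phi>_ge_0: "k \<le> L \<Longrightarrow> 0 \<le> \<phi> L a k n"
  using a_pos by (intro \<phi>_nonneg) (auto simp: less_imp_le)

lemma \<phi>_le_1: "k \<le> L \<Longrightarrow> \<phi> L a k n \<le> 1"
  using L_ge by (cases "k = 0") (auto simp: \<phi>_0 \<theta>_le_1 \<phi>_pos_eq share_le_1)

lemma \<phi>_empty: "k \<le> L \<Longrightarrow> n k = 0 \<Longrightarrow> \<phi> L a k n = 0"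
proof (cases "k = 0")
  case True
  moreover assume "n k = 0"
  ultimately have "\<theta> n j = 0" for j by (induction j) (auto simp: x_def)
  with True show ?thesis by (simp add: \<phi>_0)
next
  case False
  moreover assume "n k = 0" "k \<le> L"
  ultimately show ?thesis by (simp add: \<phi>_pos_eq share_def x_def)
qed

abbreviation rate :: "(nat \<Rightarrow> nat) \<Rightarrow> (nat \<Rightarrow> nat) \<Rightarrow> real" where
  "rate \<equiv> network_rate L lam mu a"

text \<open>
  The generator of the process. A downward move out of \<open>n k = 0\<close> needs no special case: truncated
  subtraction makes it trivial.
\<close>

definition drift :: "((nat \<Rightarrow> nat) \<Rightarrow> real) \<Rightarrow> (nat \<Rightarrow> nat) \<Rightarrow> real" where
  "drift f n = (\<Sum>k\<le>L. lam k * (f (n(k := n k + 1)) - f n)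
                    + mu k * \<phi> L a k n * (f (n(k := n k - 1)) - f n))"

lemma exit_rate_pos: "0 < exit_rate rate n"
  by (intro exit_rate_network_pos lam_pos mu_pos a_pos)

lemma exit_rate_le: "exit_rate rate n \<le> (\<Sum>k\<le>L. lam k + mu k)"
  unfolding exit_rate_network using \<phi>_le_1 \<phi>_ge_0 mu_pos
  by (intro sum_mono add_left_mono) (auto simp: less_imp_le mult_left_le)

lemma sum_rate:
  fixes f :: "(nat \<Rightarrow> nat) \<Rightarrow> real"
  defines "B \<equiv> \<lambda>n. (\<lambda>k. n(k := n k + 1)) ` {..L} \<union> (\<lambda>k. n(k := n k - 1)) ` {..L}"
  shows "(\<Sum>m\<in>B n. rate n m * f m) =
    (\<Sum>k\<le>L. lam k * f (n(k := n k + 1)) + mu k * \<phi> L a k n * f (n(k := n k - 1)))"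
proof -
  have B: "finite (B n)" by (simp add: B_def)
  have "rate n m = (\<Sum>k\<le>L. (if m = n(k := n k + 1) then lam k else 0)
      + (if m = n(k := n k - 1) then mu k * \<phi> L a k n else 0))" for m
    unfolding network_rate_def
  proof (intro sum.cong refl)
    fix k assume "k \<in> {..L}"
    then show "(if m = n(k := n k + 1) then lam k else 0)
        + (if 0 < n k \<and> m = n(k := n k - 1) then mu k * \<phi> L a k n else 0) =
      (if m = n(k := n k + 1) then lam k else 0) + (if m = n(k := n k - 1) then mu k * \<phi> L a k n else 0)"
      using \<phi>_empty[of k n] by (cases "n k = 0") simp_all
  qed
  then have "(\<Sum>m\<in>B n. rate n m * f m) = (\<Sum>k\<le>L. \<Sum>m\<in>B n.
      (if m = n(k := n k + 1) then lam k * f m else 0)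
    + (if m = n(k := n k - 1) then mu k * \<phi> L a k n * f m else 0))"
    by (simp only: sum_distrib_right sum.swap[of _ "B n"] if_distrib[of "\<lambda>c. c * f _"]
          mult_zero_left distrib_right)
  also have "\<dots> = (\<Sum>k\<le>L. lam k * f (n(k := n k + 1)) + mu k * \<phi> L a k n * f (n(k := n k - 1)))"
  proof (intro sum.cong refl)
    fix k assume "k \<in> {..L}"
    then have "n(k := n k + 1) \<in> B n" "n(k := n k - 1) \<in> B n" by (auto simp: B_def)
    then show "(\<Sum>m\<in>B n. (if m = n(k := n k + 1) then lam k * f m else 0)
        + (if m = n(k := n k - 1) then mu k * \<phi> L a k n * f m else 0)) =
        lam k * f (n(k := n k + 1)) + mu k * \<phi> L a k n * f (n(k := n k - 1))"
      unfolding sum.distrib sum.delta[OF B] by simp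
  qed
  finally show ?thesis .
qed

lemma drift_eq_sum_minus_exit:
  "drift f n = (\<Sum>k\<le>L. lam k * f (n(k := n k + 1)) + mu k * \<phi> L a k n * f (n(k := n k - 1)))
     - exit_rate rate n * f n"
  unfolding drift_def exit_rate_network sum_distrib_right sum_subtractf[symmetric]
  by (intro sum.cong refl) (auto simp: algebra_simps \<phi>_empty)

lemma nn_integral_jump_pmf:
  assumes V: "\<And>m. 0 \<le> V m"
  shows "(\<integral>\<^sup>+m. ennreal (V m) \<partial>jump_pmf rate n) = ennreal (V n + drift V n / exit_rate rate n)"
proof -
  let ?B = "(\<lambda>k. n(k := n k + 1)) ` {..L} \<union> (\<lambda>k. n(k := n k - 1)) ` {..L}"
  let ?e = "exit_rate rate n"
  have nonneg: "0 \<le> rate m j" for m j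
    using lam_pos mu_pos a_pos by (intro network_rate_nonneg) (auto simp: less_imp_le)
  have self: "rate n n = 0"
    unfolding network_rate_def
  proof (intro sum.neutral ballI)
    fix k
    have "n \<noteq> n(k := n k + 1)" by (metis fun_upd_same n_not_Suc_n Suc_eq_plus1)
    then have up: "(n = n(k := n k + 1)) = False" by (simp only: simp_thms)
    have "n \<noteq> n(k := n k - 1)" if "0 < n k"
      using that by (metis fun_upd_same diff_less less_irrefl zero_less_one)
    then have down: "(0 < n k \<and> n = n(k := n k - 1)) = False" by blast
    show "(if n = n(k := n k + 1) then lam k else 0)
        + (if 0 < n k \<and> n = n(k := n k - 1) then mu k * \<phi> L a k n else 0) = 0"
      by (simp only: up down if_False add_0_left)
  qed
  have zero: "rate n m = 0" if "m \<notin> ?B" for m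
    unfolding network_rate_def using that by (intro sum.neutral ballI) (auto simp: image_iff)
  have pmf: "pmf (jump_pmf rate n) m = rate n m / ?e" for m
    using self by (subst pmf_jump_pmf[OF nonneg finite_network_rate exit_rate_pos]) auto
  have "(\<integral>\<^sup>+m. ennreal (V m) \<partial>jump_pmf rate n) = (\<Sum>m\<in>?B. ennreal (V m) * ennreal (rate n m / ?e))"
    unfolding nn_integral_measure_pmf pmf
    using zero by (subst nn_integral_count_space'[of ?B]) (auto simp: mult.commute)
  also have "\<dots> = (\<Sum>m\<in>?B. ennreal (rate n m * V m / ?e))"
    using V nonneg exit_rate_pos[of n] by (intro sum.cong refl) (simp add: ennreal_mult[symmetric] mult.commute)
  also have "\<dots> = ennreal ((\<Sum>m\<in>?B. rate n m * V m) / ?e)"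
    unfolding sum_divide_distrib using V nonneg exit_rate_pos[of n]
    by (intro sum_ennreal) (auto intro!: divide_nonneg_nonneg mult_nonneg_nonneg simp: less_imp_le)
  also have "(\<Sum>m\<in>?B. rate n m * V m) / ?e = V n + drift V n / ?e"
    unfolding sum_rate using exit_rate_pos[of n] by (simp add: drift_eq_sum_minus_exit field_simps)
  finally show ?thesis .
qed

lemma jump_stays_in_states:
  assumes "n \<in> states L"
  shows "set_pmf (jump_pmf rate n) \<subseteq> states L"
proof
  fix m assume "m \<in> set_pmf (jump_pmf rate n)"
  moreover have nonneg: "0 \<le> rate m j" for m j
    using lam_pos mu_pos a_pos by (intro network_rate_nonneg) (auto simp: less_imp_le)
  ultimately have "rate n m \<noteq> 0"
    by (auto simp: set_pmf_iff pmf_jump_pmf[OF nonneg finite_network_rate exit_rate_pos] split: if_splits)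
  then obtain k where "k \<le> L" "m = n(k := n k + 1) \<or> m = n(k := n k - 1)"
    unfolding network_rate_def by (rule sum.not_neutral_contains_not_neutral) (auto split: if_splits)
  with assms show "m \<in> states L" by (auto simp: states_def)
qed

lemma positive_recurrent_if_drift:
  assumes i: "i \<in> states L" and V: "\<And>n. 0 \<le> V n"
    and neg: "\<And>n. n \<in> states L \<Longrightarrow> n \<noteq> i \<Longrightarrow> drift V n \<le> -1"
  shows "positive_recurrent rate i"
proof (rule foster_lyapunov)
  \<comment> \<open>The value at i is lowered to 0, which only helps at the other states.\<close>
  define U where "U n = (if n = i then 0 else if n \<in> states L then ennreal (V n) else \<infinity>)" for n
  have le: "(\<integral>\<^sup>+m. U m \<partial>jump_pmf rate n) \<le> ennreal (V n + drift V n / exit_rate rate n)"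
    if "n \<in> states L" for n
  proof -
    have "(\<integral>\<^sup>+m. U m \<partial>jump_pmf rate n) \<le> (\<integral>\<^sup>+m. ennreal (V m) \<partial>jump_pmf rate n)"
      using jump_stays_in_states[OF that] by (intro nn_integral_mono_AE) (auto simp: U_def AE_measure_pmf_iff)
    then show ?thesis by (simp only: nn_integral_jump_pmf[OF V])
  qed
  show "(\<integral>\<^sup>+m. U m \<partial>jump_pmf rate i) < \<infinity>"
    using le[OF i] by (rule le_less_trans) simp
  show "U i = 0" by (simp add: U_def)
  show "(\<integral>\<^sup>+m. U m \<partial>jump_pmf rate n) + ennreal (1 / exit_rate rate n) \<le> U n" if n: "n \<noteq> i" for n
  proof (cases "n \<in> states L")
    case True
    let ?I = "V n + drift V n / exit_rate rate n"
    have *: "?I \<le> V n - 1 / exit_rate rate n"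
      using divide_right_mono[OF neg[OF True n], of "exit_rate rate n"] exit_rate_pos[of n] by simp
    show ?thesis
    proof (cases "0 \<le> ?I")
      case pos: True
      have "(\<integral>\<^sup>+m. U m \<partial>jump_pmf rate n) + ennreal (1 / exit_rate rate n) \<le> ennreal ?I + ennreal (1 / exit_rate rate n)"
        by (intro add_right_mono le True)
      also have "\<dots> = ennreal (?I + 1 / exit_rate rate n)"
        using pos exit_rate_pos[of n] by (intro ennreal_plus[symmetric]) auto
      also have "\<dots> \<le> U n" using n True * by (auto simp: U_def intro!: ennreal_leI)
      finally show ?thesis .
    next
      case False
      have "V n + drift V n / exit_rate rate n =
          (\<Sum>k\<le>L. lam k * V (n(k := n k + 1)) + mu k * \<phi> L a k n * V (n(k := n k - 1))) / exit_rate rate n"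
        using exit_rate_pos[of n] by (simp add: drift_eq_sum_minus_exit field_simps)
      also have "\<dots> \<ge> 0"
        using V lam_pos mu_pos \<phi>_ge_0 exit_rate_pos[of n]
        by (intro divide_nonneg_nonneg sum_nonneg add_nonneg_nonneg mult_nonneg_nonneg) (auto simp: less_imp_le)
      finally show ?thesis using False by simp
    qed
  qed (use n in \<open>simp add: U_def\<close>)
qed (use exit_rate_pos exit_rate_le in auto)

end

section \<open>Uniform irreducibility\<close>

lemma share_pos: "0 \<le> t \<Longrightarrow> 0 < x \<Longrightarrow> 0 < share t x"
  by (simp add: share_def)

lemma share_antimono:
  assumes "0 \<le> s" "s \<le> t" "0 \<le> x"
  shows "share t x \<le> share s x"
  unfolding share_def using assms by (intro divide_left_mono) auto

text \<open>
  Against an inflow that does not exceed its own load, a class receives at least the smaller of half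
  the link and its load.
\<close>

lemma share_diag_ge:
  assumes "0 < c" "c \<le> x" "0 \<le> t" "t \<le> x"
  shows "min c (1/2) \<le> share t x"
proof -
  have "min c (1/2) \<le> share x x"
  proof (cases "1 \<le> x + x")
    case True
    then show ?thesis using assms by (simp add: share_def max_def min_def)
  next
    case False
    then show ?thesis using assms by (simp add: share_def max_def)
  qed
  also have "\<dots> \<le> share t x" using assms by (intro share_antimono) auto
  finally show ?thesis .
qed

lemma \<theta>\<^sub>0_Suc_eq_share:
  assumes "\<And>k. 0 \<le> x k"
  shows "\<theta>\<^sub>0 x (Suc k) = share (x (Suc k)) (\<theta>\<^sub>0 x k)"
  using assms by (simp add: share_eq_min \<theta>\<^sub>0_nonneg add.commute)

context linear_network
begin

text \<open>
  The passage of class 0 through the links \<open>2, \<dots>, L\<close> is bounded below in terms of the loads there,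
  because the outflow of a link is increasing in its inflow.
\<close>

lemma \<theta>_lower_bound:
  assumes "0 < t" "1 \<le> j" "j \<le> L"
  shows "\<exists>\<tau>>0. \<forall>n. (\<forall>k\<in>{2..L}. n k = i k) \<longrightarrow> t \<le> \<theta> n 1 \<longrightarrow> \<tau> \<le> \<theta> n j"
  using assms(2,3)
proof (induction j rule: dec_induct)
  case base
  then show ?case using assms(1) by blast
next
  case (step j)
  then obtain \<tau> where \<tau>: "0 < \<tau>"
    "\<And>n. \<forall>k\<in>{2..L}. n k = i k \<Longrightarrow> t \<le> \<theta> n 1 \<Longrightarrow> \<tau> \<le> \<theta> n j" by auto
  show ?case
  proof (intro exI[of _ "share (x i (Suc j)) \<tau>"] conjI allI impI)
    show "0 < share (x i (Suc j)) \<tau>" using \<tau>(1) by (simp add: share_pos)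
    fix n assume n: "\<forall>k\<in>{2..L}. n k = i k" "t \<le> \<theta> n 1"
    then have "x n (Suc j) = x i (Suc j)" using step by (simp add: x_def)
    then show "share (x i (Suc j)) \<tau> \<le> \<theta> n (Suc j)"
      using \<tau>(2)[OF n] \<tau>(1) by (simp add: \<theta>\<^sub>0_Suc_eq_share share_mono del: \<theta>\<^sub>0.simps)
  qed
qed

text \<open>
  Away from the target \<open>i\<close> some coordinate can move towards \<open>i\<close> at a rate bounded below uniformly in
  \<open>n\<close>. This is not obvious, since a class may be served arbitrarily slowly: class 1 if \<open>x n 0\<close> is
  large, class 0 if some \<open>x n k\<close> is large. If a coordinate is below its target, an arrival helps. A
  class \<open>k \<ge> 2\<close> above its target competes with an inflow of at most 1. If all those classes are at
  their targets, then of the classes 0 and 1 either one is at its target as well and the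
  other one is not slowed down too much, or the one with the larger load is served well.
\<close>

lemma uniform_step_towards:
  assumes i: "i \<in> states L"
  shows "\<exists>\<pi>>0. \<forall>n\<in>states L. n \<noteq> i \<longrightarrow>
    (\<exists>k\<le>L. n k < i k \<and> \<pi> \<le> lam k \<or> i k < n k \<and> \<pi> \<le> mu k * \<phi> L a k n)"
proof -
  have a0: "0 < a 0" and a1: "0 < a 1" using a_pos L_ge by auto
  define t where "t = min (share (x i 1) (a 0)) (min (a 0) (1/2))"
  have "0 < t" using a0 by (simp add: t_def share_pos)
  from \<theta>_lower_bound[OF this L_ge order_refl, of i] obtain \<tau> where \<tau>: "0 < \<tau>"
    "\<And>n. \<forall>k\<in>{2..L}. n k = i k \<Longrightarrow> t \<le> \<theta> n 1 \<Longrightarrow> \<tau> \<le> \<theta> n L" by auto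
  define c where "c = min (share (x i 0) (a 1)) (min (a 1) (1/2))"
  have c: "0 < c" using a1 by (simp add: c_def share_pos)
  define R where "R = lam ` {..L} \<union> (\<lambda>k. mu k * share 1 (a k)) ` {2..L} \<union> {mu 1 * c, mu 0 * \<tau>}"
  have R: "finite R" "R \<noteq> {}" "\<And>r. r \<in> R \<Longrightarrow> 0 < r"
    using lam_pos mu_pos a_pos c \<tau>(1) L_ge by (auto simp: R_def share_pos)
  obtain \<pi> where \<pi>: "0 < \<pi>" and le: "\<And>r. r \<in> R \<Longrightarrow> \<pi> \<le> r"
    using R by (intro that[of "Min R"]) auto
  have le_lam: "\<pi> \<le> lam k" if "k \<le> L" for k using that by (intro le) (auto simp: R_def)
  have le_mu: "\<pi> \<le> mu k * share 1 (a k)" if "k \<in> {2..L}" for k using that by (intro le) (auto simp: R_def)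
  have le_1: "\<pi> \<le> mu 1 * c" and le_0: "\<pi> \<le> mu 0 * \<tau>" by (auto intro!: le simp: R_def)
  show ?thesis
  proof (intro exI[of _ \<pi>] conjI ballI impI)
    show "0 < \<pi>" by fact
    fix n assume n: "n \<in> states L" "n \<noteq> i"
    have x_ge: "a k \<le> x n k" if "k \<le> L" "i k < n k" for k
      using that mult_left_mono[of 1 "real (n k)" "a k"] a_pos[of k] by (simp add: x_def)
    consider (up) k where "k \<le> L" "n k < i k" | (down) k where "k \<in> {2..L}" "i k < n k"
      | (rest) "\<And>k. k \<le> L \<Longrightarrow> i k \<le> n k" "\<forall>k\<in>{2..L}. n k = i k"
      by (metis atLeastAtMost_iff antisym not_le)
    then show "\<exists>k\<le>L. n k < i k \<and> \<pi> \<le> lam k \<or> i k < n k \<and> \<pi> \<le> mu k * \<phi> L a k n"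
    proof cases
      case up
      then show ?thesis using le_lam[of k] by auto
    next
      case down
      then have k: "k \<le> L" "1 \<le> k" "1 \<le> k - 1" by auto
      have "share 1 (a k) \<le> share 1 (x n k)"
        using down x_ge[of k] a_pos[of k] by (intro share_mono) auto
      also have "\<dots> \<le> \<phi> L a k n"
        unfolding \<phi>_pos_eq[OF k(2,1)] using k by (intro share_antimono \<theta>_le_1) auto
      finally have "\<pi> \<le> mu k * \<phi> L a k n"
        using le_mu[OF down(1)] mult_left_mono[of "share 1 (a k)" "\<phi> L a k n" "mu k"] mu_pos[OF k(1)]
        by linarith
      then show ?thesis using down by auto
    next
      case rest
      have ex: "i 0 < n 0 \<or> i 1 < n 1"
      proof (rule ccontr)
        assume *: "\<not> ?thesis"
        have "n k = i k" for k
        proof (cases "k \<in> {2..L}")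
          case True
          then show ?thesis using rest by simp
        next
          case False
          then consider "k = 0" | "k = 1" | "k > L" by force
          then show ?thesis
            using rest(1)[of 0] rest(1)[of 1] L_ge * n i by cases (auto simp: states_def)
        qed
        with n show False by auto
      qed
      show ?thesis
      \<comment> \<open>Only class 0 or class 1 is off its target. Class 1 is the one to move if class 0 does not
        block link 1; otherwise class 0 is, and it passes link 1 at a rate of at least t.\<close>
      proof (cases "i 1 < n 1 \<and> (n 0 = i 0 \<or> x n 0 \<le> x n 1)")
        case True
        then have x1: "a 1 \<le> x n 1" using x_ge L_ge by auto
        have "c \<le> share (x n 0) (x n 1)"
        proof (cases "n 0 = i 0")
          case True
          then have "x n 0 = x i 0" by (simp add: x_def)
          then have "share (x i 0) (a 1) \<le> share (x n 0) (x n 1)"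
            using x1 a1 by (simp add: share_mono)
          then show ?thesis by (simp add: c_def)
        next
          case False
          then show ?thesis
            using share_diag_ge[of "a 1" "x n 1" "x n 0"] x1 a1 True by (simp add: c_def)
        qed
        then have "\<pi> \<le> mu 1 * \<phi> L a 1 n"
          using le_1 mult_left_mono[OF _ less_imp_le[OF mu_pos[OF L_ge]], of c "share (x n 0) (x n 1)"]
            \<phi>_pos_eq[OF order_refl L_ge, of n] by simp
        then show ?thesis using True L_ge by auto
      next
        case False
        then have i0: "i 0 < n 0" and alt: "n 1 = i 1 \<or> x n 1 \<le> x n 0"
          using ex rest(1)[of 0] rest(1)[of 1] L_ge by force+
        have x0: "a 0 \<le> x n 0" using x_ge i0 by auto
        have "t \<le> share (x n 1) (x n 0)"
          using alt
        proof
          assume "n 1 = i 1"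
          then have "x n 1 = x i 1" by (simp add: x_def)
          then have "share (x i 1) (a 0) \<le> share (x n 1) (x n 0)"
            using x0 a0 by (simp add: share_mono)
          then show ?thesis by (simp add: t_def)
        next
          assume "x n 1 \<le> x n 0"
          then show ?thesis
            using share_diag_ge[of "a 0" "x n 0" "x n 1"] x0 a0 by (simp add: t_def)
        qed
        then have "t \<le> \<theta> n 1" by (subst \<theta>\<^sub>0_1_eq_share) auto
        with \<tau>(2) rest have "\<tau> \<le> \<phi> L a 0 n" by (simp add: \<phi>_0)
        then have "\<pi> \<le> mu 0 * \<phi> L a 0 n"
          using le_0 mult_left_mono[OF _ less_imp_le[OF mu_pos[of 0]], of \<tau> "\<phi> L a 0 n"] by simp
        then show ?thesis using i0 by auto
      qed
    qed
  qed
qed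

lemma drift_cmult: "drift (\<lambda>n. c * f n) n = c * drift f n"
  unfolding drift_def sum_distrib_left by (intro sum.cong refl) (simp add: algebra_simps)

lemma drift_add: "drift (\<lambda>n. f n + g n) n = drift f n + drift g n"
  unfolding drift_def sum.distrib[symmetric] by (intro sum.cong refl) (simp add: algebra_simps)

lemma drift_const: "drift (\<lambda>n. c) n = 0"
  by (simp add: drift_def)

text \<open>
  For \<open>\<beta>\<close> small, the bounded function \<open>- \<beta> ^ d\<close> of the distance \<open>d\<close> to the target has negative drift at
  every other state: a step towards the target changes it by \<open>1 / \<beta>\<close> times as much as a step away.
\<close>

lemma drift_geometric_distance:
  assumes i: "i \<in> states L"
  defines "d \<equiv> \<lambda>n. \<Sum>k\<le>L. (n k - i k) + (i k - n k)"
  shows "\<exists>\<beta>>0. \<beta> < 1 \<and> (\<exists>\<pi>>0. \<forall>n\<in>states L. n \<noteq> i \<longrightarrow> drift (\<lambda>n. - (\<beta> ^ d n)) n \<le> - (\<pi> * \<beta> ^ d n))"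
proof -
  obtain \<pi> where \<pi>: "0 < \<pi>" and towards: "\<And>n. n \<in> states L \<Longrightarrow> n \<noteq> i \<Longrightarrow>
    \<exists>k\<le>L. n k < i k \<and> \<pi> \<le> lam k \<or> i k < n k \<and> \<pi> \<le> mu k * \<phi> L a k n"
    using uniform_step_towards[OF i] by blast
  define \<Lambda> where "\<Lambda> = (\<Sum>k\<le>L. lam k + mu k)"
  have \<Lambda>: "0 < \<Lambda>"
    unfolding \<Lambda>_def using lam_pos mu_pos by (intro sum_pos add_pos_pos) auto
  \<comment> \<open>All moves away together happen at rate at most \<Lambda> and weigh \<beta> times a move towards the target.\<close>
  define \<beta> where "\<beta> = min (1/2) (\<pi> / (2 * \<Lambda>))"
  have \<beta>: "0 < \<beta>" "\<beta> < 1" "\<Lambda> * \<beta> \<le> \<pi> / 2"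
    using \<pi> \<Lambda> by (auto simp: \<beta>_def min_def field_simps)
  let ?g = "\<lambda>n. - (\<beta> ^ d n)"
  have d_upd: "d (n(k := v)) + ((n k - i k) + (i k - n k)) = d n + ((v - i k) + (i k - v))"
    if "k \<le> L" for n k v
    using that unfolding d_def by (subst (1 2) sum.remove[of _ k]) (auto intro!: sum.cong)
  have "drift ?g n \<le> - (\<pi> / 4 * \<beta> ^ d n)" if n: "n \<in> states L" "n \<noteq> i" for n
  proof -
    let ?e = "\<beta> ^ d n * (1 - \<beta>)"
    have e: "0 \<le> ?e" using \<beta> by simp
    have far: "?g m - ?g n \<le> ?e" if "d m \<le> Suc (d n)" for m
    proof -
      have "\<beta> ^ Suc (d n) \<le> \<beta> ^ d m" using \<beta> that by (intro power_decreasing) auto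
      then show ?thesis by (simp add: algebra_simps)
    qed
    have near: "?g m - ?g n = - (?e / \<beta>)" if "d n = Suc (d m)" for m
      using \<beta> that by (simp add: field_simps)
    have up: "d (n(k := n k + 1)) \<le> Suc (d n)" and down: "d (n(k := n k - 1)) \<le> Suc (d n)"
      if "k \<le> L" for k
      using d_upd[OF that, of n "n k + 1"] d_upd[OF that, of n "n k - 1"] by arith+
    obtain l where l: "l \<le> L" "n l < i l \<and> \<pi> \<le> lam l \<or> i l < n l \<and> \<pi> \<le> mu l * \<phi> L a l n"
      using towards[OF n] by blast
    let ?T = "\<lambda>k. lam k * (?g (n(k := n k + 1)) - ?g n) + mu k * \<phi> L a k n * (?g (n(k := n k - 1)) - ?g n)"
    have A: "lam k * (?g (n(k := n k + 1)) - ?g n) \<le> lam k * ?e" if "k \<le> L" for k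
      using lam_pos[OF that] far[OF up[OF that]] by (intro mult_left_mono) auto
    have B: "mu k * \<phi> L a k n * (?g (n(k := n k - 1)) - ?g n) \<le> mu k * ?e" if "k \<le> L" for k
    proof -
      have "mu k * \<phi> L a k n * (?g (n(k := n k - 1)) - ?g n) \<le> mu k * \<phi> L a k n * ?e"
        using mu_pos[OF that] \<phi>_ge_0[OF that] far[OF down[OF that]]
        by (intro mult_left_mono mult_nonneg_nonneg) auto
      also have "\<dots> \<le> mu k * 1 * ?e"
        using mu_pos[OF that] \<phi>_le_1[OF that] e by (intro mult_right_mono mult_left_mono) auto
      finally show ?thesis by simp
    qed
    have l_le: "?T l \<le> (lam l + mu l) * ?e - \<pi> * (?e / \<beta>)"
      using l(2)
    proof
      assume *: "n l < i l \<and> \<pi> \<le> lam l"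
      then have "d n = Suc (d (n(l := n l + 1)))"
        using d_upd[OF l(1), of n "n l + 1"] by auto
      then have "?g (n(l := n l + 1)) - ?g n = - (?e / \<beta>)" by (rule near)
      then have "lam l * (?g (n(l := n l + 1)) - ?g n) = - (lam l * (?e / \<beta>))"
        by (simp only: mult_minus_right)
      also have "\<dots> \<le> - (\<pi> * (?e / \<beta>))"
        using * e \<beta> by (intro le_imp_neg_le mult_right_mono divide_nonneg_nonneg) auto
      also have "\<dots> \<le> lam l * ?e - \<pi> * (?e / \<beta>)"
        using e lam_pos[OF l(1)] by simp
      finally show ?thesis using B[OF l(1)] by (simp only: distrib_right)
    next
      assume *: "i l < n l \<and> \<pi> \<le> mu l * \<phi> L a l n"
      then have "d n = Suc (d (n(l := n l - 1)))"
        using d_upd[OF l(1), of n "n l - 1"] by auto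
      then have "?g (n(l := n l - 1)) - ?g n = - (?e / \<beta>)" by (rule near)
      then have "mu l * \<phi> L a l n * (?g (n(l := n l - 1)) - ?g n) = - (mu l * \<phi> L a l n * (?e / \<beta>))"
        by (simp only: mult_minus_right)
      also have "\<dots> \<le> - (\<pi> * (?e / \<beta>))"
        using * e \<beta> by (intro le_imp_neg_le mult_right_mono divide_nonneg_nonneg) auto
      also have "\<dots> \<le> mu l * ?e - \<pi> * (?e / \<beta>)"
        using e mu_pos[OF l(1)] by simp
      finally show ?thesis using A[OF l(1)] by (simp only: distrib_right)
    qed
    have "drift ?g n \<le> (\<Sum>k\<le>L. (lam k + mu k) * ?e - (if k = l then \<pi> * (?e / \<beta>) else 0))"
      unfolding drift_def
    proof (intro sum_mono)
      fix k assume "k \<in> {..L}"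
      then have "k \<le> L" by simp
      show "?T k \<le> (lam k + mu k) * ?e - (if k = l then \<pi> * (?e / \<beta>) else 0)"
      proof (cases "k = l")
        case True
        then show ?thesis using l_le by simp
      next
        case False
        then show ?thesis using add_mono[OF A B, OF \<open>k \<le> L\<close> \<open>k \<le> L\<close>] by (simp only: distrib_right if_False diff_0_right)
      qed
    qed
    also have "\<dots> = \<Lambda> * ?e - \<pi> * (?e / \<beta>)"
      using l(1) by (simp add: sum_subtractf \<Lambda>_def sum_distrib_right)
    also have "\<dots> = (\<Lambda> * \<beta> - \<pi>) * (?e / \<beta>)"
      using \<beta> by (simp add: field_simps)
    also have "\<dots> \<le> - (\<pi> / 2) * (?e / \<beta>)"
      using \<beta> e by (intro mult_right_mono divide_nonneg_nonneg) auto
    also have "\<dots> \<le> - (\<pi> / 2) * (\<beta> ^ d n / 2)"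
    proof -
      have "1 / 2 \<le> (1 - \<beta>) / \<beta>" using \<beta>(1) by (simp add: field_simps) (simp add: \<beta>_def)
      then have "\<beta> ^ d n * (1 / 2) \<le> \<beta> ^ d n * ((1 - \<beta>) / \<beta>)"
        using \<beta>(1) by (intro mult_left_mono) auto
      then have "\<beta> ^ d n / 2 \<le> ?e / \<beta>" by simp
      then show ?thesis using \<pi> by (intro mult_left_mono_neg) auto
    qed
    finally show ?thesis by simp
  qed
  then show ?thesis using \<beta> \<pi> by (intro exI[of _ \<beta>] conjI exI[of _ "\<pi> / 4"]) auto
qed

text \<open>
  Negative drift outside a finite set suffices for the return to each single state \<open>i\<close>. A large
  multiple of the preceding bounded function repairs the drift on the finite set and does not spoil
  it elsewhere, because its own drift is negative everywhere except at \<open>i\<close>.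
\<close>

theorem ergodic_if_drift:
  assumes V: "\<And>n. 0 \<le> V n"
    and fin: "finite {n \<in> states L. \<not> drift V n \<le> -1}"
  shows "ergodic (states L) rate"
  unfolding ergodic_def
proof
  fix i assume i: "i \<in> states L"
  define d where "d n = (\<Sum>k\<le>L. (n k - i k) + (i k - n k))" for n
  from drift_geometric_distance[OF i] obtain \<beta> \<pi> where \<beta>: "0 < \<beta>" "\<beta> < 1" and \<pi>: "0 < \<pi>"
    and g: "\<And>n. n \<in> states L \<Longrightarrow> n \<noteq> i \<Longrightarrow> drift (\<lambda>n. - (\<beta> ^ d n)) n \<le> - (\<pi> * \<beta> ^ d n)"
    unfolding d_def by blast
  let ?F = "{n \<in> states L. \<not> drift V n \<le> -1}"
  define A where "A = Max (insert 0 ((\<lambda>n. (drift V n + 1) / (\<pi> * \<beta> ^ d n)) ` ?F))"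
  have A: "0 \<le> A" "\<And>n. n \<in> ?F \<Longrightarrow> (drift V n + 1) / (\<pi> * \<beta> ^ d n) \<le> A"
    using fin by (auto simp: A_def)
  let ?W = "\<lambda>n. V n + A * (1 + - (\<beta> ^ d n))"
  show "positive_recurrent rate i"
  proof (rule positive_recurrent_if_drift[OF i])
    show "0 \<le> ?W n" for n
      using V A(1) \<beta> by (auto intro!: add_nonneg_nonneg mult_nonneg_nonneg power_le_one)
    fix n assume n: "n \<in> states L" "n \<noteq> i"
    have "drift ?W n = drift V n + A * drift (\<lambda>n. - (\<beta> ^ d n)) n"
      unfolding drift_add drift_cmult drift_const by simp
    also have "\<dots> \<le> drift V n - A * (\<pi> * \<beta> ^ d n)"
      using mult_left_mono[OF g[OF n] A(1)] by simp
    also have "\<dots> \<le> -1"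
    proof (cases "drift V n \<le> -1")
      case True
      moreover have "0 \<le> A * (\<pi> * \<beta> ^ d n)" using A(1) \<pi> \<beta> by simp
      ultimately show ?thesis by linarith
    next
      case False
      then have "(drift V n + 1) / (\<pi> * \<beta> ^ d n) \<le> A" using A(2) n by simp
      then show ?thesis using \<pi> \<beta> by (simp add: divide_le_eq)
    qed
    finally show "drift ?W n \<le> -1" .
  qed
qed

end

section \<open>The drift of two large classes\<close>

text \<open>
  The drift of the classes 0 and 1 when they are large, divided by a power of their total load. Here
  \<open>u\<close> is the fraction of the load due to class 0, which is the rate at which link 1 lets class 0
  pass, and \<open>\<rho>0 + \<delta>\<close> is what the other links can carry. For \<open>u \<le> 1 - \<rho>1\<close> the second summand is
  nonpositive and outweighs a positive first one. For \<open>u > 1 - \<rho>1\<close> class 1 grows, but its weight is smaller by a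
  factor \<open>(1 - t) ^ p\<close> where the growth rate is at most \<open>t\<close>; since \<open>(1 - t) ^ p * t \<le> 1 / p\<close>, a high
  power \<open>p\<close> makes this negligible.
\<close>

lemma planar_weights_negative:
  fixes \<rho>0 \<rho>1 \<delta> :: real
  assumes \<rho>0: "0 < \<rho>0" and \<rho>1: "0 < \<rho>1" and \<delta>: "0 < \<delta>" "\<rho>0 + \<delta> \<le> 1 - \<rho>1"
    and p: "1 \<le> p" "1 < real p * \<delta>" and u: "0 \<le> u" "u \<le> 1"
  shows "u ^ p * (\<rho>0 - min u (\<rho>0 + \<delta>)) + ((1 - u) * (1 - \<rho>1) / \<rho>1) ^ p * (\<rho>1 - (1 - u)) < 0"
proof -
  have \<rho>1': "\<rho>1 < 1" using \<rho>0 \<delta> by linarith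
  let ?r = "(1 - u) * (1 - \<rho>1) / \<rho>1"
  have r: "0 \<le> ?r" using u \<rho>1 \<rho>1' by simp
  consider (zero) "u = 0" | (low) "0 < u" "u \<le> 1 - \<rho>1" | (high) "1 - \<rho>1 < u"
    using u by linarith
  then show ?thesis
  proof cases
    case zero
    have "0 < (1 - \<rho>1) / \<rho>1" using \<rho>1 \<rho>1' by simp
    then show ?thesis using zero p \<rho>1' by (simp add: zero_power mult_pos_neg)
  next
    case low
    have "u * \<rho>1 \<le> (1 - u) * (1 - \<rho>1)"
      using low by (simp add: algebra_simps)
    then have "u \<le> ?r" using \<rho>1 by (simp add: le_divide_eq)
    then have "u ^ p \<le> ?r ^ p" using low by (intro power_mono) auto
    then have "?r ^ p * (\<rho>1 - (1 - u)) \<le> u ^ p * (\<rho>1 - (1 - u))"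
      using low by (intro mult_right_mono_neg) auto
    then have "u ^ p * (\<rho>0 - min u (\<rho>0 + \<delta>)) + ?r ^ p * (\<rho>1 - (1 - u))
        \<le> u ^ p * (\<rho>0 - min u (\<rho>0 + \<delta>) + (\<rho>1 - (1 - u)))"
      by (simp only: distrib_left)
    also have "\<dots> < 0"
      using low \<delta> by (intro mult_pos_neg) (auto simp: min_def)
    finally show ?thesis .
  next
    case high
    define t where "t = (u - (1 - \<rho>1)) / \<rho>1"
    have t: "0 < t" "t \<le> 1" using high u \<rho>1 by (auto simp: t_def field_simps)
    have ut: "u - (1 - \<rho>1) = \<rho>1 * t" using \<rho>1 by (simp add: t_def)
    have "?r = (1 - \<rho>1) * (1 - t)" using \<rho>1 by (simp add: t_def field_simps)
    also have "\<dots> \<le> u * (1 - t)" using high t by (intro mult_right_mono) auto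
    finally have "?r ^ p \<le> u ^ p * (1 - t) ^ p"
      using r by (subst power_mult_distrib[symmetric]) (intro power_mono, auto)
    have "(1 - t) ^ p * (1 + real p * t) \<le> (1 - t) ^ p * (1 + t) ^ p"
      using t Bernoulli_inequality[of t p] by (intro mult_left_mono) auto
    also have "\<dots> = (1 - t * t) ^ p"
      by (subst power_mult_distrib[symmetric]) (simp add: algebra_simps)
    also have "\<dots> \<le> 1" using t by (intro power_le_one) (auto simp: mult_le_one)
    finally have "(1 - t) ^ p * (1 + real p * t) \<le> 1" .
    then have "(1 - t) ^ p * (real p * t) \<le> 1 - (1 - t) ^ p"
      by (simp add: algebra_simps)
    also have "\<dots> \<le> 1" using t by simp
    finally have "real p * ((1 - t) ^ p * t) \<le> 1" by (simp add: ac_simps)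
    also have "\<dots> < real p * \<delta>" by (rule p)
    finally have pt: "(1 - t) ^ p * t < \<delta>"
      using p(1) by (simp add: mult_less_cancel_left)
    have "?r ^ p * (\<rho>1 - (1 - u)) \<le> u ^ p * (1 - t) ^ p * (\<rho>1 - (1 - u))"
      using \<open>?r ^ p \<le> _\<close> high by (intro mult_right_mono) auto
    also have "\<dots> = u ^ p * (\<rho>1 * ((1 - t) ^ p * t))"
      using ut by (simp add: algebra_simps)
    also have "\<dots> \<le> u ^ p * (1 * ((1 - t) ^ p * t))"
      using u \<rho>1' t by (intro mult_left_mono mult_right_mono) auto
    finally have "u ^ p * (\<rho>0 - min u (\<rho>0 + \<delta>)) + ?r ^ p * (\<rho>1 - (1 - u))
      \<le> u ^ p * (- \<delta> + (1 - t) ^ p * t)"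
      using high \<delta> by (simp add: min_def algebra_simps)
    also have "\<dots> < 0"
      using high \<rho>1' pt by (intro mult_pos_neg) auto
    finally show ?thesis .
  qed
qed

lemma planar_weights:
  fixes \<rho>0 \<rho>1 \<delta> :: real
  assumes "0 < \<rho>0" "0 < \<rho>1" "0 < \<delta>" "\<rho>0 + \<delta> \<le> 1 - \<rho>1"
  shows "\<exists>q. \<exists>\<eta>>0. \<forall>u\<in>{0..1}. u ^ Suc q * (\<rho>0 - min u (\<rho>0 + \<delta>))
    + ((1 - u) * (1 - \<rho>1) / \<rho>1) ^ Suc q * (\<rho>1 - (1 - u)) \<le> - 2 * \<eta>"
proof -
  \<comment> \<open>Strict negativity becomes a uniform margin by compactness of the unit interval.\<close>
  obtain q :: nat where "1 / \<delta> < real q" using reals_Archimedean2 by blast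
  then have "1 < real q * \<delta>" using assms(3) by (simp add: divide_less_eq)
  then have q: "1 \<le> Suc q" "1 < real (Suc q) * \<delta>" using assms(3) by (auto simp: algebra_simps)
  define f where "f u = u ^ Suc q * (\<rho>0 - min u (\<rho>0 + \<delta>))
    + ((1 - u) * (1 - \<rho>1) / \<rho>1) ^ Suc q * (\<rho>1 - (1 - u))" for u
  have "continuous_on {0..1} f"
    unfolding f_def using assms(2) by (intro continuous_intros) auto
  then obtain v where v: "v \<in> {0..1}" "\<And>u. u \<in> {0..1} \<Longrightarrow> f u \<le> f v"
    using continuous_attains_sup[of "{0..1::real}" f] by auto
  have "f v < 0" unfolding f_def using planar_weights_negative[OF assms q] v(1) by auto
  then have "0 < - f v / 2" "\<forall>u\<in>{0..1}. f u \<le> - 2 * (- f v / 2)" using v(2) by auto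
  then show ?thesis unfolding f_def by blast
qed

section \<open>Estimates for powers\<close>

text \<open>
  The error of the first-order expansion of a power, with a remainder of lower degree. By induction:
  multiplying by \<open>x + h\<close> turns the remainder \<open>E\<close> into \<open>(x + h) * E\<close> plus one new term.
\<close>

lemma power_first_order_error:
  fixes x h :: real
  assumes "0 \<le> x" "\<bar>h\<bar> \<le> 1" "0 \<le> x + h"
  shows "\<bar>(x + h) ^ Suc (Suc n) - x ^ Suc (Suc n) - real (Suc (Suc n)) * h * x ^ Suc n\<bar>
    \<le> (real (Suc (Suc n)))\<^sup>2 * h\<^sup>2 * (1 + x) ^ n"
proof (induction n)
  case 0
  have "(x + h) ^ 2 - x ^ 2 - 2 * h * x = h\<^sup>2" by (simp add: power2_eq_square algebra_simps)
  then show ?case by (simp add: power2_eq_square)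
next
  case (Suc n)
  let ?E = "(x + h) ^ Suc (Suc n) - x ^ Suc (Suc n) - real (Suc (Suc n)) * h * x ^ Suc n"
  have "(x + h) ^ Suc (Suc (Suc n)) - x ^ Suc (Suc (Suc n)) - real (Suc (Suc (Suc n))) * h * x ^ Suc (Suc n)
      = (x + h) * ?E + real (Suc (Suc n)) * h\<^sup>2 * x ^ Suc n"
    by (simp add: power2_eq_square algebra_simps)
  also have "\<bar>\<dots>\<bar> \<le> \<bar>(x + h) * ?E\<bar> + \<bar>real (Suc (Suc n)) * h\<^sup>2 * x ^ Suc n\<bar>"
    by (rule abs_triangle_ineq)
  also have "\<dots> \<le> (1 + x) * ((real (Suc (Suc n)))\<^sup>2 * h\<^sup>2 * (1 + x) ^ n)
      + real (Suc (Suc n)) * h\<^sup>2 * (1 + x) ^ Suc n"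
  proof (intro add_mono)
    show "\<bar>(x + h) * ?E\<bar> \<le> (1 + x) * ((real (Suc (Suc n)))\<^sup>2 * h\<^sup>2 * (1 + x) ^ n)"
      unfolding abs_mult using Suc assms by (intro mult_mono) auto
    have "x ^ Suc n \<le> (1 + x) ^ Suc n" using assms by (intro power_mono) auto
    then show "\<bar>real (Suc (Suc n)) * h\<^sup>2 * x ^ Suc n\<bar> \<le> real (Suc (Suc n)) * h\<^sup>2 * (1 + x) ^ Suc n"
      using assms by (auto simp: abs_mult intro!: mult_left_mono)
  qed
  also have "\<dots> = ((real (Suc (Suc n)))\<^sup>2 + real (Suc (Suc n))) * (h\<^sup>2 * (1 + x) ^ Suc n)"
    by (simp add: algebra_simps)
  also have "\<dots> \<le> (real (Suc (Suc (Suc n))))\<^sup>2 * (h\<^sup>2 * (1 + x) ^ Suc n)"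
    using assms by (intro mult_right_mono mult_nonneg_nonneg) (auto simp: power2_eq_square algebra_simps)
  finally show ?case by (simp only: mult.assoc)
qed

lemma power_Suc_diff_le:
  fixes s t :: real
  assumes "1 \<le> s" "0 \<le> t" "t \<le> s + 1"
  shows "t ^ Suc q - s ^ Suc q \<le> real (Suc q) * (2 * s) ^ q"
proof -
  have "(s + 1) ^ Suc q - s ^ Suc q \<le> real (Suc q) * (s + 1) ^ q"
  proof (induction q)
    case (Suc q)
    have "(s + 1) ^ Suc (Suc q) - s ^ Suc (Suc q)
        = (s + 1) ^ Suc q + s * ((s + 1) ^ Suc q - s ^ Suc q)"
      by (simp add: algebra_simps)
    also have "\<dots> \<le> (s + 1) ^ Suc q + s * (real (Suc q) * (s + 1) ^ q)"
      using Suc assms by (intro add_left_mono mult_left_mono) auto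
    also have "\<dots> \<le> (s + 1) ^ Suc q + (s + 1) * (real (Suc q) * (s + 1) ^ q)"
      using assms by (intro add_left_mono mult_right_mono) auto
    finally show ?case by (simp add: algebra_simps)
  qed simp
  moreover have "t ^ Suc q \<le> (s + 1) ^ Suc q" using assms by (intro power_mono) auto
  moreover have "real (Suc q) * (s + 1) ^ q \<le> real (Suc q) * (2 * s) ^ q"
    using assms by (intro mult_left_mono power_mono) auto
  ultimately show ?thesis by linarith
qed

lemma lower_order_absorbed:
  fixes \<sigma> c :: real
  assumes \<sigma>: "0 < \<sigma>" and c: "0 \<le> c"
  shows "\<exists>C\<ge>0. \<forall>x\<ge>0. c * (1 + x) ^ q \<le> \<sigma> * x ^ Suc q + C"
proof -
  define M where "M = max 1 (c * 2 ^ q / \<sigma>)"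
  have M: "1 \<le> M" by (simp add: M_def)
  show ?thesis
  proof (intro exI[of _ "c * (1 + M) ^ q"] conjI allI impI)
    show "0 \<le> c * (1 + M) ^ q" using M c by simp
    fix x :: real assume x: "0 \<le> x"
    show "c * (1 + x) ^ q \<le> \<sigma> * x ^ Suc q + c * (1 + M) ^ q"
    proof (cases "x \<le> M")
      case True
      then have "c * (1 + x) ^ q \<le> c * (1 + M) ^ q" using x c by (intro mult_left_mono power_mono) auto
      moreover have "0 \<le> \<sigma> * x ^ Suc q" using x \<sigma> by (intro mult_nonneg_nonneg zero_le_power) auto
      ultimately show ?thesis by linarith
    next
      case False
      then have "c * 2 ^ q / \<sigma> \<le> x" by (simp add: M_def)
      then have "c * 2 ^ q \<le> \<sigma> * x" using \<sigma> by (simp add: divide_le_eq mult.commute)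
      have "c * (1 + x) ^ q \<le> c * (2 * x) ^ q"
        using False M c by (intro mult_left_mono power_mono) auto
      also have "\<dots> = c * 2 ^ q * x ^ q" by (simp add: power_mult_distrib)
      also have "\<dots> \<le> \<sigma> * x * x ^ q"
        using \<open>c * 2 ^ q \<le> _\<close> x by (intro mult_right_mono) auto
      finally have "c * (1 + x) ^ q \<le> \<sigma> * x ^ Suc q" by (simp add: ac_simps)
      then show ?thesis using M c by (simp add: add_increasing2)
    qed
  qed
qed

lemma power_mult_le_Young:
  fixes s y \<kappa> :: real
  assumes "0 \<le> s" "0 \<le> y" "0 < \<kappa>"
  shows "s ^ q * y \<le> \<kappa> * s ^ Suc q + (1 / \<kappa>) ^ q * y ^ Suc q"
proof (cases "y \<le> \<kappa> * s")
  case True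
  then have "s ^ q * y \<le> s ^ q * (\<kappa> * s)" using assms by (intro mult_left_mono) auto
  moreover have "0 \<le> (1 / \<kappa>) ^ q * y ^ Suc q"
    using assms by (intro mult_nonneg_nonneg zero_le_power) auto
  ultimately show ?thesis by (simp add: ac_simps)
next
  case False
  then have "s \<le> 1 / \<kappa> * y" using assms by (simp add: field_simps)
  then have "s ^ q \<le> (1 / \<kappa> * y) ^ q" using assms by (intro power_mono) auto
  then have "s ^ q * y \<le> (1 / \<kappa> * y) ^ q * y" using assms by (intro mult_right_mono) auto
  also have "\<dots> = (1 / \<kappa>) ^ q * y ^ Suc q" by (simp add: power_mult_distrib power_divide)
  finally show ?thesis using assms by (simp add: add_increasing)
qed

text \<open>
  A class on link \<open>k \<ge> 2\<close> competes with an inflow \<open>t \<le> 1\<close> and gets almost the whole link when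
  its load is large, which is more than its traffic intensity.
\<close>

lemma large_queue_drains:
  fixes \<rho> c :: real
  assumes "\<rho> < 1" "0 \<le> c"
  shows "\<exists>C\<ge>0. \<forall>x\<ge>0. \<forall>t. 0 \<le> t \<longrightarrow> t \<le> 1 \<longrightarrow>
    x ^ Suc q * (\<rho> - share t x) + c * (1 + x) ^ q \<le> - ((1 - \<rho>) / 2) * x ^ Suc q + C"
proof -
  obtain C where C: "0 \<le> C" "\<And>x. 0 \<le> x \<Longrightarrow> (c + 1) * (1 + x) ^ q \<le> ((1 - \<rho>) / 2) * x ^ Suc q + C"
    using lower_order_absorbed[of "(1 - \<rho>) / 2" "c + 1" q] assms by auto
  have "x ^ Suc q * (\<rho> - share t x) + c * (1 + x) ^ q \<le> - ((1 - \<rho>) / 2) * x ^ Suc q + C"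
    if x: "0 \<le> x" and t: "0 \<le> t" "t \<le> 1" for x t
  proof -
    have "share 1 x \<le> share t x" using t x by (intro share_antimono) auto
    moreover have "share 1 x = 1 - 1 / (1 + x)" using x by (simp add: share_def field_simps)
    ultimately have "x ^ Suc q * (\<rho> - share t x) \<le> x ^ Suc q * (\<rho> - 1 + 1 / (1 + x))"
      using x by (intro mult_left_mono zero_le_power) auto
    also have "\<dots> = - (1 - \<rho>) * x ^ Suc q + x ^ Suc q / (1 + x)"
      by (simp add: algebra_simps)
    also have "x ^ Suc q / (1 + x) \<le> (1 + x) ^ Suc q / (1 + x)"
      using x by (intro divide_right_mono power_mono) auto
    also have "\<dots> = (1 + x) ^ q" using x by simp
    finally have "x ^ Suc q * (\<rho> - share t x) \<le> - (1 - \<rho>) * x ^ Suc q + (1 + x) ^ q" by simp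
    moreover have "(c + 1) * (1 + x) ^ q = c * (1 + x) ^ q + (1 + x) ^ q" by (simp add: algebra_simps)
    moreover have "- (1 - \<rho>) * x ^ Suc q = - ((1 - \<rho>) / 2) * x ^ Suc q - ((1 - \<rho>) / 2) * x ^ Suc q"
      by (simp add: field_simps)
    ultimately show ?thesis using C(2)[OF x] by linarith
  qed
  then show ?thesis using C(1) by blast
qed

section \<open>A smooth absolute value\<close>

text \<open>
  A smooth substitute for \<open>\<bar>z\<bar>\<close>. The kink of \<open>\<bar>z\<bar>\<close> would produce a positive drift at \<open>z = 0\<close> that
  does not get smaller with the jumps when divided by their size; for \<open>soft_abs\<close> a jump of size \<open>h\<close> costs only \<open>h\<^sup>2 / (2 * e)\<close> beyond the linear
  term.
\<close>

definition soft_abs :: "real \<Rightarrow> real \<Rightarrow> real" where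
  "soft_abs e z = sqrt (z\<^sup>2 + e\<^sup>2)"

lemma soft_abs_pos: "0 < e \<Longrightarrow> 0 < soft_abs e z"
  by (simp add: soft_abs_def add_nonneg_pos)

lemma soft_abs_ge: "0 < e \<Longrightarrow> e \<le> soft_abs e z" "\<bar>z\<bar> \<le> soft_abs e z"
  by (auto simp: soft_abs_def intro: real_le_rsqrt)

lemma soft_abs_le: "0 < e \<Longrightarrow> soft_abs e z \<le> \<bar>z\<bar> + e"
  unfolding soft_abs_def using sqrt_sum_squares_le_sum_abs[of z e] by simp

lemma soft_abs_sq: "(soft_abs e z)\<^sup>2 = z\<^sup>2 + e\<^sup>2"
  by (simp add: soft_abs_def)

lemma soft_abs_step:
  assumes "0 < e"
  shows "soft_abs e (z + h) \<le> soft_abs e z + z / soft_abs e z * h + h\<^sup>2 / (2 * e)"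
proof -
  let ?s = "soft_abs e z" and ?t = "soft_abs e (z + h)"
  have pos: "0 < ?s" "e \<le> ?s" using soft_abs_pos soft_abs_ge assms by auto
  have "2 * ?s * ?t \<le> ?s\<^sup>2 + ?t\<^sup>2" using sum_squares_ge_zero[of "?s - ?t" 0]
    by (simp add: power2_eq_square algebra_simps)
  also have "\<dots> = 2 * ?s\<^sup>2 + 2 * z * h + h\<^sup>2"
    unfolding soft_abs_sq by (simp add: power2_eq_square algebra_simps)
  finally have "?t \<le> ?s + z / ?s * h + h\<^sup>2 / (2 * ?s)"
    using pos by (simp add: field_simps power2_eq_square)
  moreover have "h\<^sup>2 / (2 * ?s) \<le> h\<^sup>2 / (2 * e)"
    using pos assms by (intro divide_left_mono) auto
  ultimately show ?thesis by linarith
qed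

lemma soft_abs_lipschitz:
  assumes "0 < e"
  shows "soft_abs e z - soft_abs e w \<le> \<bar>z - w\<bar>"
proof -
  have "sqrt ((w + (z - w))\<^sup>2 + (e + 0)\<^sup>2) \<le> sqrt (w\<^sup>2 + e\<^sup>2) + sqrt ((z - w)\<^sup>2 + 0\<^sup>2)"
    by (rule real_sqrt_sum_squares_triangle_ineq)
  then show ?thesis by (simp add: soft_abs_def)
qed

text \<open>
  One link of the cascade. If the inflow is \<open>m\<close>, the load \<open>y\<close> is in equilibrium: the class is served at
  the rate \<open>\<rho>\<close> at which work arrives. The deviation \<open>x - y\<close> then shrinks at a rate controlled by
  \<open>\<bar>share m x - \<rho>\<bar>\<close>, up to the smoothing error \<open>e\<close>, and a wrong inflow \<open>t\<close> costs at most \<open>\<bar>t - m\<bar>\<close>.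
\<close>

lemma soft_abs_share:
  assumes e: "0 < e" and "0 \<le> t" "0 \<le> m" "0 \<le> x" "0 \<le> y" and eq: "share m y = \<rho>"
  shows "(x - y) / soft_abs e (x - y) * (\<rho> - share t x) \<le> \<bar>t - m\<bar> - \<bar>share m x - \<rho>\<bar> + e"
proof -
  let ?z = "x - y" and ?G = "soft_abs e (x - y)" and ?s = "share m x - \<rho>"
  have G: "0 < ?G" "\<bar>?z\<bar> \<le> ?G" "?G \<le> \<bar>?z\<bar> + e"
    using soft_abs_pos soft_abs_ge soft_abs_le e by auto
  have d: "\<bar>?z / ?G\<bar> \<le> 1" using G by simp
  have s: "\<bar>?s\<bar> \<le> \<bar>?z\<bar>" using share_lipschitz[of m x y] assms by simp
  have "0 \<le> ?z * ?s"
    using share_mono[of m x y] share_mono[of m y x] assms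
    by (cases "x \<le> y") (auto intro: mult_nonneg_nonneg mult_nonpos_nonpos)
  then have zs: "?z * ?s = \<bar>?z\<bar> * \<bar>?s\<bar>" by (simp only: abs_mult[symmetric] abs_of_nonneg)
  have "\<bar>?s\<bar> * ?G \<le> \<bar>?s\<bar> * \<bar>?z\<bar> + e * ?G"
  proof -
    have "\<bar>?s\<bar> * ?G \<le> \<bar>?s\<bar> * (\<bar>?z\<bar> + e)" using G by (intro mult_left_mono) auto
    moreover have "\<bar>?s\<bar> * e \<le> ?G * e" using G s e by (intro mult_right_mono) auto
    ultimately show ?thesis by (simp add: algebra_simps)
  qed
  then have 1: "?z / ?G * (- ?s) \<le> - \<bar>?s\<bar> + e"
    using G(1) zs by (simp add: field_simps)
  have "?z / ?G * (share m x - share t x) \<le> \<bar>?z / ?G\<bar> * \<bar>share m x - share t x\<bar>"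
    by (metis abs_ge_self abs_mult)
  also have "\<dots> \<le> 1 * \<bar>m - t\<bar>"
    using d share_lipschitz_upstream[of m t x] assms by (intro mult_mono) auto
  finally have 2: "?z / ?G * (share m x - share t x) \<le> \<bar>t - m\<bar>" by simp
  have "?z / ?G * (\<rho> - share t x) = ?z / ?G * (- ?s) + ?z / ?G * (share m x - share t x)"
    unfolding distrib_left[symmetric] by simp
  then show ?thesis using 1 2 by linarith
qed

section \<open>Jumps of a single class\<close>

lemma pull_out_denominator:
  fixes d :: real
  shows "l * (X / (p * d)) + f * (Y / (p * d)) = (l * X + f * Y) / d / p"
  by (simp add: add_divide_distrib mult.commute)

lemma cancel_degree:
  fixes p A :: real
  assumes "A \<noteq> 0" "p \<noteq> 0"
  shows "(p * X * D + p\<^sup>2 * A\<^sup>2 * Z / A * R) / p = X * D + A * R * (p * Z)"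
  using assms by (simp add: power2_eq_square add_divide_distrib)

lemma pull_out_weight:
  fixes d :: real
  shows "l * (c / d * X) + f * (c / d * Y) = c * ((l * X + f * Y) / d)"
  by (simp add: add_divide_distrib distrib_left ac_simps)

context linear_network
begin

definition rho :: "nat \<Rightarrow> real" where
  "rho k = lam k / mu k"

definition jump :: "nat \<Rightarrow> ((nat \<Rightarrow> nat) \<Rightarrow> real) \<Rightarrow> (nat \<Rightarrow> nat) \<Rightarrow> real" where
  "jump k f n = lam k * (f (n(k := n k + 1)) - f n) + mu k * \<phi> L a k n * (f (n(k := n k - 1)) - f n)"

lemma rho_pos: "k \<le> L \<Longrightarrow> 0 < rho k"
  using lam_pos mu_pos by (simp add: rho_def)

lemma drift_eq_jumps: "drift f n = jump 0 f n + jump 1 f n + (\<Sum>k\<in>{2..L}. jump k f n)"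
proof -
  have "{..L} = insert 0 (insert 1 {2..L})" using L_ge by auto
  then show ?thesis by (simp add: drift_def jump_def)
qed

lemma jump_eq_0:
  assumes "\<And>v. f (n(k := v)) = f n"
  shows "jump k f n = 0"
  by (simp add: jump_def assms)

lemma jump_le:
  assumes k: "k \<le> L"
    and up: "f (n(k := n k + 1)) - f n \<le> A"
    and down: "0 < n k \<Longrightarrow> f (n(k := n k - 1)) - f n \<le> B"
  shows "jump k f n \<le> lam k * A + mu k * \<phi> L a k n * B"
proof -
  have "mu k * \<phi> L a k n * (f (n(k := n k - 1)) - f n) \<le> mu k * \<phi> L a k n * B"
    using \<phi>_empty[OF k, of n] down mu_pos[OF k] \<phi>_ge_0[OF k, of n]
    by (cases "n k = 0") (auto intro!: mult_left_mono)
  moreover have "lam k * (f (n(k := n k + 1)) - f n) \<le> lam k * A"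
    by (intro mult_left_mono up less_imp_le[OF lam_pos[OF k]])
  ultimately show ?thesis unfolding jump_def by linarith
qed

lemma x_up: "k \<le> L \<Longrightarrow> x (n(k := n k + 1)) k = x n k + a k"
  by (simp add: x_def algebra_simps)

lemma x_down: "k \<le> L \<Longrightarrow> 0 < n k \<Longrightarrow> x (n(k := n k - 1)) k = x n k - a k"
  by (simp add: x_def algebra_simps of_nat_diff)

lemma x_other: "j \<noteq> k \<Longrightarrow> x (n(k := v)) j = x n j"
  by (simp add: x_def)

text \<open>
  Dividing by \<open>a k * mu k\<close> puts all classes on the same time scale: the linear part of the drift
  becomes a multiple of \<open>rho k - \<phi> L a k n\<close> that does not involve \<open>a k\<close>, so that the estimates are
  uniform in the ratios of the access rates.
\<close>

lemma jump_scaled: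
  assumes k: "k \<le> L"
  shows "(lam k * (b * a k + c) + mu k * \<phi> L a k n * (- b * a k + c)) / (a k * mu k)
    = b * (rho k - \<phi> L a k n) + c / a k * (rho k + \<phi> L a k n)"
  using a_pos[OF k] mu_pos[OF k] by (simp add: rho_def field_simps)

text \<open>
  Normalised such that the leading term of its drift is \<open>x n k ^ Suc q * (rho k - \<phi> L a k n)\<close>.
\<close>

definition monomial :: "nat \<Rightarrow> nat \<Rightarrow> (nat \<Rightarrow> nat) \<Rightarrow> real" where
  "monomial q k n = x n k ^ Suc (Suc q) / (real (Suc (Suc q)) * (a k * mu k))"

lemma monomial_nonneg: "k \<le> L \<Longrightarrow> 0 \<le> monomial q k n"
  unfolding monomial_def using a_pos[of k] mu_pos[of k]
  by (intro divide_nonneg_nonneg zero_le_power mult_nonneg_nonneg) auto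

lemma jump_monomial:
  assumes k: "k \<le> L" "a k \<le> 1" "rho k \<le> 1"
  shows "jump k (monomial q k) n
    \<le> x n k ^ Suc q * (rho k - \<phi> L a k n) + 2 * real (Suc (Suc q)) * (1 + x n k) ^ q"
proof -
  let ?p = "real (Suc (Suc q))" and ?x = "x n k"
  let ?c = "?p\<^sup>2 * (a k)\<^sup>2 * (1 + ?x) ^ q" and ?b = "?p * ?x ^ Suc q" and ?d = "?p * (a k * mu k)"
  have ak: "0 < a k" and muk: "0 < mu k" using a_pos mu_pos k by auto
  have d: "0 < ?d" using ak muk by simp
  have "jump k (monomial q k) n \<le> lam k * ((?b * a k + ?c) / ?d) + mu k * \<phi> L a k n * ((- ?b * a k + ?c) / ?d)"
  proof (rule jump_le[OF k(1)])
    have "(?x + a k) ^ Suc (Suc q) - ?x ^ Suc (Suc q) \<le> ?b * a k + ?c"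
      using power_first_order_error[of ?x "a k" q] ak k by (simp add: ac_simps)
    then show "monomial q k (n(k := n k + 1)) - monomial q k n \<le> (?b * a k + ?c) / ?d"
      unfolding monomial_def x_up[OF k(1)] diff_divide_distrib[symmetric] using d
      by (intro divide_right_mono) auto
    assume nk: "0 < n k"
    have "0 \<le> ?x + - a k"
      using x_nonneg[of "n(k := n k - 1)" k] unfolding x_down[of k n, OF k(1) nk] by simp
    then have "(?x - a k) ^ Suc (Suc q) - ?x ^ Suc (Suc q) \<le> - ?b * a k + ?c"
      using power_first_order_error[of ?x "- a k" q] ak k by (simp add: ac_simps)
    then show "monomial q k (n(k := n k - 1)) - monomial q k n \<le> (- ?b * a k + ?c) / ?d"
      unfolding monomial_def x_down[of k n, OF k(1) nk] diff_divide_distrib[symmetric] using d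
      by (intro divide_right_mono) auto
  qed
  also have "\<dots> = ((lam k * (?b * a k + ?c) + mu k * \<phi> L a k n * (- ?b * a k + ?c)) / (a k * mu k)) / ?p"
    by (rule pull_out_denominator)
  also have "\<dots> = ?x ^ Suc q * (rho k - \<phi> L a k n) + (a k * (rho k + \<phi> L a k n)) * (?p * (1 + ?x) ^ q)"
    unfolding jump_scaled[OF k(1)] using ak by (intro cancel_degree) auto
  also have "(a k * (rho k + \<phi> L a k n)) * (?p * (1 + ?x) ^ q) \<le> (1 * (1 + 1)) * (?p * (1 + ?x) ^ q)"
    using ak k \<phi>_le_1[OF k(1)] \<phi>_ge_0[OF k(1)] rho_pos[OF k(1)]
    by (intro mult_right_mono mult_mono add_mono mult_nonneg_nonneg) (auto intro: add_nonneg_nonneg)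
  finally show ?thesis by (simp only: mult.assoc one_add_one mult_1_left)
qed

section \<open>Equilibrium of the links behind the first one\<close>

text \<open>
  The rate at which class 0 leaves link \<open>k\<close> if it leaves link 1 at rate \<open>u\<close> and every class on the
  links \<open>2, \<dots>, k\<close> is served at the rate at which its work arrives. Link 1 imposes no further bound:
  its influence is contained in \<open>u\<close>. The value at 0 is a convention.
\<close>

fun ideal :: "real \<Rightarrow> nat \<Rightarrow> real" where
  "ideal u 0 = u"
| "ideal u (Suc k) = (if k = 0 then u else min (ideal u k) (1 - rho (Suc k)))"

text \<open>
  The equilibrium load of class \<open>k\<close> against the inflow \<open>ideal u (k - 1)\<close>: the solution \<open>y\<close> of
  \<open>share (ideal u (k - 1)) y = rho k\<close>. The maximum distinguishes a link with spare capacity from a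
  saturated one.
\<close>

definition target :: "real \<Rightarrow> nat \<Rightarrow> real" where
  "target u k = max (rho k) (ideal u (k - 1) * rho k / (1 - rho k))"

text \<open>
  The rate of class 0 after link 1. If the classes 0 and 1 are large, it changes slowly compared with
  the loads on the other links.
\<close>

definition u :: "(nat \<Rightarrow> nat) \<Rightarrow> real" where
  "u n = \<theta> n 1"

text \<open>
  The total load of the classes 0 and 1, cut off at 1 such that \<open>u n = x n 0 / S n\<close> without exception.
\<close>

definition S :: "(nat \<Rightarrow> nat) \<Rightarrow> real" where
  "S n = max 1 (x n 0 + x n 1)"

lemma u_bounds: "0 \<le> u n" "u n \<le> 1"
  by (simp_all add: u_def \<theta>_le_1 del: \<theta>\<^sub>0.simps)

lemma u_eq: "u n = x n 0 / S n"
  unfolding u_def S_def by (subst \<theta>\<^sub>0_1_eq_share) (auto simp: share_def add.commute)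

lemma S_ge_1: "1 \<le> S n"
  by (simp add: S_def)

end

locale stable_network = linear_network +
  fixes \<delta> :: real
  assumes \<delta>_pos: "0 < \<delta>"
    and load: "\<And>k. 1 \<le> k \<Longrightarrow> k \<le> L \<Longrightarrow> rho 0 + \<delta> \<le> 1 - rho k"
    and a_le_1: "\<And>k. k \<le> L \<Longrightarrow> a k \<le> 1"
begin

lemma rho_0_lt_1: "rho 0 < 1"
  using load[of 1] L_ge \<delta>_pos rho_pos[of 1] by simp

lemma rho_lt_1: "1 \<le> k \<Longrightarrow> k \<le> L \<Longrightarrow> rho k < 1"
  using load[of k] \<delta>_pos rho_pos[of 0] by simp

lemma ideal_bounds:
  assumes "0 \<le> v" "v \<le> 1" "k \<le> L"
  shows "0 \<le> ideal v k" "ideal v k \<le> 1" "min v (rho 0 + \<delta>) \<le> ideal v k"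
  using assms(3)
proof (induction k)
  case (Suc k)
  { case 1 then show ?case using Suc assms rho_lt_1[of "Suc k"] by auto }
  { case 2 then show ?case using Suc assms by auto }
  { case 3 then show ?case using Suc assms load[of "Suc k"] by auto }
qed (use assms in auto)

lemma share_target:
  assumes "0 \<le> v" "v \<le> 1" "1 \<le> k" "k \<le> L"
  shows "share (ideal v (k - 1)) (target v k) = rho k"
proof -
  let ?t = "ideal v (k - 1)" and ?r = "rho k"
  have t: "0 \<le> ?t" using assms ideal_bounds[of v "k - 1"] by auto
  have r: "0 < ?r" "?r < 1" using assms rho_pos rho_lt_1 by auto
  show ?thesis
  proof (cases "?t + ?r \<le> 1")
    case True
    then have "?t * ?r \<le> (1 - ?r) * ?r" using r by (intro mult_right_mono) auto
    then have "?t * ?r / (1 - ?r) \<le> ?r" using r by (simp add: divide_le_eq mult.commute)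
    then have "target v k = ?r" by (simp add: target_def)
    then show ?thesis using True by (simp add: share_def)
  next
    case False
    then have "(1 - ?r) * ?r \<le> ?t * ?r" using r by (intro mult_right_mono) auto
    then have "?r \<le> ?t * ?r / (1 - ?r)" using r by (simp add: le_divide_eq mult.commute)
    then have y: "target v k = ?t * ?r / (1 - ?r)" by (simp add: target_def)
    have sum: "?t + target v k = ?t / (1 - ?r)" using r by (simp add: y field_simps)
    moreover have "1 \<le> ?t / (1 - ?r)" using False r by (simp add: le_divide_eq)
    ultimately have "share ?t (target v k) = target v k / (?t / (1 - ?r))"
      by (simp add: share_def)
    also have "\<dots> = ?r" using False r by (simp add: y field_simps)
    finally show ?thesis .
  qed
qed

lemma target_bounds:
  assumes "0 \<le> v" "v \<le> 1" "1 \<le> k" "k \<le> L"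
  shows "0 \<le> target v k" "target v k \<le> rho k / (1 - rho k)"
proof -
  have r: "0 < rho k" "rho k < 1" using assms rho_pos rho_lt_1 by auto
  have "ideal v (k - 1) \<le> 1" using ideal_bounds[of v "k - 1"] assms by auto
  then have "ideal v (k - 1) * rho k / (1 - rho k) \<le> 1 * rho k / (1 - rho k)"
    using r by (intro divide_right_mono mult_right_mono) auto
  moreover have "rho k \<le> rho k / (1 - rho k)" using r by (simp add: le_divide_eq mult_left_le)
  ultimately show "target v k \<le> rho k / (1 - rho k)" by (simp add: target_def)
  show "0 \<le> target v k" using r by (simp add: target_def le_max_iff_disj)
qed

lemma ideal_lipschitz: "\<bar>ideal v k - ideal w k\<bar> \<le> \<bar>v - w\<bar>"
  by (induction k) (auto simp: min_def)

lemma target_lipschitz: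
  assumes "1 \<le> k" "k \<le> L"
  shows "\<bar>target v k - target w k\<bar> \<le> rho k / (1 - rho k) * \<bar>v - w\<bar>"
proof -
  let ?c = "rho k / (1 - rho k)"
  have c: "0 \<le> ?c" using assms rho_pos[of k] rho_lt_1[of k] by simp
  have "\<bar>target v k - target w k\<bar> \<le> \<bar>ideal v (k - 1) * ?c - ideal w (k - 1) * ?c\<bar>"
    unfolding target_def by (simp add: max_def)
  also have "\<dots> = ?c * \<bar>ideal v (k - 1) - ideal w (k - 1)\<bar>"
    using c by (simp only: left_diff_distrib[symmetric] abs_mult abs_of_nonneg mult.commute)
  also have "\<dots> \<le> ?c * \<bar>v - w\<bar>" using c ideal_lipschitz by (intro mult_left_mono) auto
  finally show ?thesis .
qed

end

section \<open>The corrector\<close>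

text \<open>
  The parameters of the Lyapunov function: the degree \<open>Suc (Suc q)\<close> of its main part, the drift margin \<open>\<eta>\<close>
  and the smoothing width \<open>e\<close>. They can be chosen in terms of \<open>L\<close> and the traffic intensities; the
  access rates then have to be small compared with \<open>e\<close>.
\<close>

locale lyapunov = stable_network +
  fixes e \<eta> :: real and q :: nat
  assumes e_pos: "0 < e" and \<eta>_pos: "0 < \<eta>"
    and small: "\<And>k. k \<le> L \<Longrightarrow> 2 ^ L * (e + a k / e) \<le> \<eta>"
    and planar: "\<And>v. 0 \<le> v \<Longrightarrow> v \<le> 1 \<Longrightarrow>
      v ^ Suc q * (rho 0 - min v (rho 0 + \<delta>))
        + ((1 - v) * (1 - rho 1) / rho 1) ^ Suc q * (rho 1 - (1 - v)) \<le> - 2 * \<eta>"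
begin

definition gap :: "(nat \<Rightarrow> nat) \<Rightarrow> nat \<Rightarrow> real" where
  "gap n k = x n k - target (u n) k"

definition weight :: "nat \<Rightarrow> real" where
  "weight k = 2 ^ (L - k) / (a k * mu k)"

text \<open>
  The corrector. It measures the distance of the links \<open>2, \<dots>, L\<close> from their equilibrium. A
  deviation on one link disturbs the inflow of all later ones, so the weights have to grow with the
  number of links still to come; doubling them per link is enough.
\<close>

definition \<Phi> :: "(nat \<Rightarrow> nat) \<Rightarrow> real" where
  "\<Phi> n = (\<Sum>k\<in>{2..L}. weight k * soft_abs e (gap n k))"

lemma weight_pos: "k \<le> L \<Longrightarrow> 0 < weight k"
  unfolding weight_def using a_pos[of k] mu_pos[of k] by simp

text \<open>
  By induction along the links. The deviation of the inflow of link \<open>j + 1\<close> enters once in the drift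
  of that link and once in the deviation of its outflow; the doubled bound for the previous
  links pays for both.
\<close>

lemma cascade:
  assumes \<kappa>: "0 \<le> \<kappa>" "\<And>k. k \<in> {2..L} \<Longrightarrow> e + a k / e \<le> \<kappa>" and "1 \<le> j" "j \<le> L"
  shows "(\<Sum>k\<in>{2..j}. 2 ^ (j - k) *
      (gap n k / soft_abs e (gap n k) * (rho k - \<phi> L a k n) + a k / e))
    \<le> (2 ^ j - 1) * \<kappa> - \<bar>\<theta> n j - ideal (u n) j\<bar>"
  using assms(3,4)
proof (induction j rule: dec_induct)
  case base
  show ?case using \<kappa>(1) by (simp add: u_def)
next
  case (step j)
  let ?T = "\<lambda>k. gap n k / soft_abs e (gap n k) * (rho k - \<phi> L a k n) + a k / e"
  let ?k = "Suc j" and ?t = "\<theta> n j" and ?m = "ideal (u n) j"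
  let ?s = "\<bar>share ?m (x n ?k) - rho ?k\<bar>" and ?d = "\<bar>?t - ?m\<bar>"
  have k: "1 \<le> ?k" "?k \<le> L" "?k \<in> {2..L}" using step by auto
  have m: "0 \<le> ?m" using ideal_bounds[of "u n" j] u_bounds step by auto
  have \<phi>: "\<phi> L a ?k n = share ?t (x n ?k)" using \<phi>_pos_eq[OF k(1,2)] by simp
  have "share ?m (target (u n) ?k) = rho ?k"
    using share_target[OF u_bounds k(1,2)] by simp
  then have "gap n ?k / soft_abs e (gap n ?k) * (rho ?k - \<phi> L a ?k n) \<le> ?d - ?s + e"
    unfolding gap_def \<phi> using e_pos m target_bounds[OF u_bounds k(1,2)] by (intro soft_abs_share) auto
  then have T: "?T ?k \<le> ?d - ?s + \<kappa>" using \<kappa>(2)[OF k(3)] by linarith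
  have "\<bar>\<theta> n ?k - ideal (u n) ?k\<bar> \<le> ?d + ?s"
  proof -
    have "\<theta> n ?k = min ?t (1 - share ?t (x n ?k))" by (rule \<theta>\<^sub>0_Suc_eq_min) simp
    moreover have "ideal (u n) ?k = min ?m (1 - rho ?k)" using step by simp
    moreover have "\<bar>share ?t (x n ?k) - share ?m (x n ?k)\<bar> \<le> ?d"
      using m by (intro share_lipschitz_upstream) auto
    ultimately show ?thesis by (auto simp: min_def abs_if split: if_splits)
  qed
  moreover have "(\<Sum>k\<in>{2..?k}. 2 ^ (?k - k) * ?T k) = 2 * (\<Sum>k\<in>{2..j}. 2 ^ (j - k) * ?T k) + ?T ?k"
  proof -
    have "(\<Sum>k\<in>{2..?k}. 2 ^ (?k - k) * ?T k) = (\<Sum>k\<in>{2..j}. 2 ^ (?k - k) * ?T k) + ?T ?k"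
      using step by simp
    also have "(\<Sum>k\<in>{2..j}. 2 ^ (?k - k) * ?T k) = 2 * (\<Sum>k\<in>{2..j}. 2 ^ (j - k) * ?T k)"
      unfolding sum_distrib_left by (intro sum.cong refl) (simp add: Suc_diff_le)
    finally show ?thesis .
  qed
  moreover have "2 * (\<Sum>k\<in>{2..j}. 2 ^ (j - k) * ?T k) \<le> 2 * ((2 ^ j - 1) * \<kappa> - ?d)"
    using step by (intro mult_left_mono step.IH) auto
  moreover have "2 * ((2 ^ j - 1) * \<kappa> - ?d) + \<kappa> = (2 ^ ?k - 1) * \<kappa> - 2 * ?d"
    by (simp add: algebra_simps)
  moreover have "s' \<le> K' - E" if "E \<le> d + r" "s' = 2 * s + T" "2 * s \<le> 2 * (K - d)"
      "2 * (K - d) + \<kappa> = K' - 2 * d" "T \<le> d - r + \<kappa>" for s s' T E d r K K' :: real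
    using that by linarith
  ultimately show ?case using T by blast
qed


lemma u_unaffected: "2 \<le> k \<Longrightarrow> u (n(k := v)) = u n"
  by (simp add: u_def x_other)

lemma S_unaffected: "2 \<le> k \<Longrightarrow> S (n(k := v)) = S n"
  by (simp add: S_def x_other)

lemma \<Phi>_upd:
  assumes "k \<in> {2..L}"
  shows "\<Phi> (n(k := v)) - \<Phi> n = weight k *
    (soft_abs e (gap n k + (x (n(k := v)) k - x n k)) - soft_abs e (gap n k))"
proof -
  have "gap (n(k := v)) j = gap n j" if "j \<noteq> k" for j
    using assms that by (simp add: gap_def u_unaffected x_other)
  then have "(\<Sum>j\<in>{2..L} - {k}. weight j * soft_abs e (gap (n(k := v)) j))
      = (\<Sum>j\<in>{2..L} - {k}. weight j * soft_abs e (gap n j))"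
    by (intro sum.cong) auto
  moreover have "gap (n(k := v)) k = gap n k + (x (n(k := v)) k - x n k)"
    using assms by (simp add: gap_def u_unaffected)
  ultimately show ?thesis
    unfolding \<Phi>_def using assms by (simp add: sum.remove[of "{2..L}" k] right_diff_distrib)
qed

lemma jump_\<Phi>:
  assumes k: "k \<in> {2..L}"
  shows "jump k \<Phi> n \<le> 2 ^ (L - k) * (gap n k / soft_abs e (gap n k) * (rho k - \<phi> L a k n) + a k / e)"
proof -
  let ?b = "gap n k / soft_abs e (gap n k)" and ?c = "(a k)\<^sup>2 / (2 * e)"
  have kL: "k \<le> L" using k by simp
  have ak: "0 < a k" and w: "0 < weight k" using a_pos weight_pos kL by auto
  have r: "rho k \<le> 1" using rho_lt_1[of k] k by simp
  have "jump k \<Phi> n \<le> lam k * (weight k * (?b * a k + ?c)) + mu k * \<phi> L a k n * (weight k * (- ?b * a k + ?c))"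
  proof (rule jump_le[OF kL])
    show "\<Phi> (n(k := n k + 1)) - \<Phi> n \<le> weight k * (?b * a k + ?c)"
      unfolding \<Phi>_upd[OF k] x_up[OF kL] using w soft_abs_step[OF e_pos, of "gap n k" "a k"]
      by (intro mult_left_mono) auto
    assume "0 < n k"
    then show "\<Phi> (n(k := n k - 1)) - \<Phi> n \<le> weight k * (- ?b * a k + ?c)"
      unfolding \<Phi>_upd[OF k] x_down[of k n, OF kL \<open>0 < n k\<close>] using w soft_abs_step[OF e_pos, of "gap n k" "- a k"]
      by (intro mult_left_mono) auto
  qed
  also have "\<dots> = 2 ^ (L - k) * ((lam k * (?b * a k + ?c) + mu k * \<phi> L a k n * (- ?b * a k + ?c)) / (a k * mu k))"
    unfolding weight_def by (rule pull_out_weight)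
  also have "\<dots> = 2 ^ (L - k) * (?b * (rho k - \<phi> L a k n) + ?c / a k * (rho k + \<phi> L a k n))"
    unfolding jump_scaled[OF kL] ..
  also have "\<dots> \<le> 2 ^ (L - k) * (?b * (rho k - \<phi> L a k n) + ?c / a k * (1 + 1))"
    using ak e_pos r \<phi>_le_1[OF kL] by (intro mult_left_mono add_left_mono add_mono) auto
  also have "?c / a k * (1 + 1) = a k / e"
    using ak e_pos by (simp add: power2_eq_square)
  finally show ?thesis .
qed

text \<open>
  While \<open>u n\<close> is frozen, the corrector has negative drift whenever the rate of class 0 differs from
  its ideal value by more than \<open>\<eta>\<close>.
\<close>

lemma fast_drift:
  "(\<Sum>k\<in>{2..L}. jump k \<Phi> n) \<le> \<eta> - \<bar>\<theta> n L - ideal (u n) L\<bar>"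
proof -
  let ?\<kappa> = "\<eta> / 2 ^ L"
  \<comment> \<open>Dividing the margin by 2 ^ L leaves room for the total of the weights.\<close>
  have "(\<Sum>k\<in>{2..L}. jump k \<Phi> n) \<le> (\<Sum>k\<in>{2..L}. 2 ^ (L - k) *
      (gap n k / soft_abs e (gap n k) * (rho k - \<phi> L a k n) + a k / e))"
    by (intro sum_mono jump_\<Phi>)
  also have "\<dots> \<le> (2 ^ L - 1) * ?\<kappa> - \<bar>\<theta> n L - ideal (u n) L\<bar>"
    using small \<eta>_pos L_ge by (intro cascade) (auto simp: field_simps)
  also have "(2 ^ L - 1) * ?\<kappa> \<le> 2 ^ L * ?\<kappa>"
    using \<eta>_pos by (intro mult_right_mono) auto
  finally show ?thesis by simp
qed

section \<open>The classes of the first link\<close>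

text \<open>
  The corrector converts the actual rate \<open>\<theta> n L\<close> of class 0 into the ideal one, for which the planar
  inequality yields the drift \<open>- \<eta>\<close> in units of \<open>S n ^ Suc q\<close>. The constant covers the region where the
  classes 0 and 1 do not fill link 1.
\<close>

lemma planar_drift:
  "\<exists>C. \<forall>n. x n 0 ^ Suc q * (rho 0 - \<theta> n L)
      + (x n 1 * (1 - rho 1) / rho 1) ^ Suc q * (rho 1 - \<phi> L a 1 n)
      + S n ^ Suc q * (\<eta> - \<bar>\<theta> n L - ideal (u n) L\<bar>) \<le> - \<eta> * S n ^ Suc q + C"
proof -
  define r where "r = (1 - rho 1) / rho 1"
  have rho1: "0 < rho 1" "rho 1 < 1" using rho_pos rho_lt_1 L_ge by auto
  have r: "0 \<le> r" using rho1 by (simp add: r_def)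
  show ?thesis
  proof (intro exI[of _ "1 + r ^ Suc q + 2 * \<eta>"] allI)
    fix n
    let ?f = "\<lambda>z. z ^ Suc q" and ?\<theta> = "\<theta> n L" and ?v = "u n"
    let ?d = "\<bar>?\<theta> - ideal ?v L\<bar>"
    have \<phi>1: "\<phi> L a 1 n = share (x n 0) (x n 1)" using \<phi>_pos_eq[OF order_refl L_ge] by simp
    have "?f (x n 0) * (rho 0 - ?\<theta>) + ?f (x n 1 * r) * (rho 1 - \<phi> L a 1 n) + ?f (S n) * (\<eta> - ?d)
        \<le> - \<eta> * ?f (S n) + (1 + ?f r + 2 * \<eta>)"
    proof (cases "1 \<le> x n 0 + x n 1")
      case True
      then have S: "S n = x n 0 + x n 1" by (simp add: S_def)
      then have S0: "0 < S n" using True by simp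
      have x0: "x n 0 = S n * ?v" using S0 by (simp add: u_eq)
      have x1: "x n 1 = S n * (1 - ?v)" using S x0 by (simp add: algebra_simps)
      have \<phi>: "\<phi> L a 1 n = 1 - ?v"
      proof -
        have "\<phi> L a 1 n = x n 1 / S n" by (simp only: \<phi>1 share_def S_def)
        then show ?thesis using S0 by (subst (asm) x1) simp
      qed
      have v: "0 \<le> ?v" "?v \<le> 1" using u_bounds by auto
      have "?f ?v * (rho 0 - ?\<theta>) \<le> ?f ?v * (rho 0 - min ?v (rho 0 + \<delta>)) + ?d"
      proof -
        have "?f ?v * (rho 0 - ?\<theta>) \<le> ?f ?v * ((rho 0 - min ?v (rho 0 + \<delta>)) + ?d)"
          using v ideal_bounds(3)[OF v order_refl] by (intro mult_left_mono zero_le_power) auto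
        also have "\<dots> = ?f ?v * (rho 0 - min ?v (rho 0 + \<delta>)) + ?f ?v * ?d"
          by (rule distrib_left)
        also have "?f ?v * ?d \<le> 1 * ?d"
          using v by (intro mult_right_mono power_le_one) auto
        finally show ?thesis by simp
      qed
      moreover have "?f ?v * (rho 0 - min ?v (rho 0 + \<delta>)) + ?f ((1 - ?v) * r) * (rho 1 - (1 - ?v)) \<le> - 2 * \<eta>"
        using planar[OF v] by (simp add: r_def)
      ultimately have "?f ?v * (rho 0 - ?\<theta>) + ?f ((1 - ?v) * r) * (rho 1 - (1 - ?v)) + (\<eta> - ?d) \<le> - \<eta>"
        by linarith
      then have "?f (S n) * (?f ?v * (rho 0 - ?\<theta>) + ?f ((1 - ?v) * r) * (rho 1 - (1 - ?v)) + (\<eta> - ?d))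
          \<le> ?f (S n) * - \<eta>"
        using S0 by (intro mult_left_mono) auto
      moreover have "?f (x n 0) = ?f (S n) * ?f ?v" by (subst x0) (rule power_mult_distrib)
      moreover have "?f (x n 1 * r) = ?f (S n) * ?f ((1 - ?v) * r)"
        by (subst x1) (simp only: power_mult_distrib mult.assoc)
      ultimately have "?f (x n 0) * (rho 0 - ?\<theta>) + ?f (x n 1 * r) * (rho 1 - \<phi> L a 1 n) + ?f (S n) * (\<eta> - ?d)
          \<le> - \<eta> * ?f (S n)"
        by (simp only: \<phi> distrib_left mult.assoc mult.commute[of _ "- \<eta>"])
      moreover have "0 \<le> ?f r" using r by (intro zero_le_power)
      ultimately show ?thesis using \<eta>_pos by linarith
    next
      case False
      then have S: "S n = 1" by (simp add: S_def)
      have x01: "x n 0 \<le> 1" "x n 1 \<le> 1" using False x_nonneg[of n 0] x_nonneg[of n 1] by linarith+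
      have "?f (x n 0) * (rho 0 - ?\<theta>) \<le> ?f (x n 0) * 1"
      proof -
        have "rho 0 - ?\<theta> \<le> 1" using rho_0_lt_1 \<theta>_nonneg[of n L] by linarith
        then show ?thesis by (intro mult_left_mono) auto
      qed
      also have "\<dots> \<le> 1" using x01 by (simp only: mult_1_right) (rule power_le_one, auto)
      finally have "?f (x n 0) * (rho 0 - ?\<theta>) \<le> 1" .
      moreover have "?f (x n 1 * r) * (rho 1 - \<phi> L a 1 n) \<le> ?f r * 1"
      proof -
        have "?f (x n 1 * r) * (rho 1 - \<phi> L a 1 n) \<le> ?f (x n 1 * r) * 1"
          using r rho1 \<phi>_ge_0[OF L_ge, of n] by (intro mult_left_mono zero_le_power) auto
        also have "?f (x n 1 * r) \<le> ?f (1 * r)"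
          using x01 r by (intro power_mono mult_right_mono) auto
        finally show ?thesis by simp
      qed
      ultimately show ?thesis using S by simp
    qed
    then show "?f (x n 0) * (rho 0 - ?\<theta>) + ?f (x n 1 * (1 - rho 1) / rho 1) * (rho 1 - \<phi> L a 1 n)
        + ?f (S n) * (\<eta> - ?d) \<le> - \<eta> * ?f (S n) + (1 + ?f r + 2 * \<eta>)"
      by (simp add: r_def)
  qed
qed


definition Y :: "(nat \<Rightarrow> nat) \<Rightarrow> real" where
  "Y n = (\<Sum>k\<in>{2..L}. x n k)"

lemma Y_nonneg: "0 \<le> Y n"
  by (simp add: Y_def sum_nonneg)

lemma \<Phi>_nonneg: "0 \<le> \<Phi> n"
  unfolding \<Phi>_def using weight_pos soft_abs_pos[OF e_pos]
  by (intro sum_nonneg mult_nonneg_nonneg) (auto simp: less_imp_le)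

lemma \<Phi>_le: "\<exists>K\<ge>0. \<forall>n. \<Phi> n \<le> K * (1 + Y n)"
proof (intro exI[of _ "\<Sum>k\<in>{2..L}. weight k * (1 + rho k / (1 - rho k) + e)"] conjI allI)
  have c: "0 \<le> rho k / (1 - rho k)" if "k \<in> {2..L}" for k
    using rho_pos[of k] rho_lt_1[of k] that by simp
  show "0 \<le> (\<Sum>k\<in>{2..L}. weight k * (1 + rho k / (1 - rho k) + e))"
    using c weight_pos e_pos by (intro sum_nonneg mult_nonneg_nonneg add_nonneg_nonneg) (auto simp: less_imp_le)
  fix n
  show "\<Phi> n \<le> (\<Sum>k\<in>{2..L}. weight k * (1 + rho k / (1 - rho k) + e)) * (1 + Y n)"
    unfolding \<Phi>_def sum_distrib_right
  proof (intro sum_mono)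
    fix k assume k: "k \<in> {2..L}"
    let ?c = "rho k / (1 - rho k)"
    have xY: "x n k \<le> Y n" unfolding Y_def using k by (intro member_le_sum) auto
    have "soft_abs e (gap n k) \<le> \<bar>gap n k\<bar> + e" by (rule soft_abs_le[OF e_pos])
    also have "\<bar>gap n k\<bar> \<le> x n k + ?c"
    proof -
      have "0 \<le> target (u n) k" "target (u n) k \<le> ?c"
        using target_bounds[OF u_bounds] k by auto
      then show ?thesis unfolding gap_def using x_nonneg[of n k] by linarith
    qed
    also have "x n k + ?c + e \<le> (1 + ?c + e) * (1 + Y n)"
    proof -
      have "1 * Y n \<le> (1 + ?c + e) * Y n"
        using c[OF k] e_pos Y_nonneg[of n] by (intro mult_right_mono) auto
      moreover have "(1 + ?c + e) * (1 + Y n) = 1 + ?c + e + (1 + ?c + e) * Y n"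
        by (simp only: distrib_left mult_1_right)
      ultimately show ?thesis using xY by linarith
    qed
    finally show "weight k * soft_abs e (gap n k) \<le> weight k * (1 + ?c + e) * (1 + Y n)"
      unfolding mult.assoc using weight_pos[of k] k by (intro mult_left_mono) auto
  qed
qed

lemma \<Phi>_slow_change:
  "\<exists>K\<ge>0. \<forall>n m. (\<forall>k\<in>{2..L}. x m k = x n k) \<longrightarrow> \<Phi> m - \<Phi> n \<le> K * \<bar>u m - u n\<bar>"
proof (intro exI[of _ "\<Sum>k\<in>{2..L}. weight k * (rho k / (1 - rho k))"] conjI allI impI)
  show "0 \<le> (\<Sum>k\<in>{2..L}. weight k * (rho k / (1 - rho k)))"
    using rho_pos rho_lt_1 weight_pos
    by (intro sum_nonneg mult_nonneg_nonneg divide_nonneg_nonneg) (auto simp: less_imp_le)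
  fix n m assume eq: "\<forall>k\<in>{2..L}. x m k = x n k"
  show "\<Phi> m - \<Phi> n \<le> (\<Sum>k\<in>{2..L}. weight k * (rho k / (1 - rho k))) * \<bar>u m - u n\<bar>"
    unfolding \<Phi>_def sum_subtractf[symmetric] sum_distrib_right right_diff_distrib[symmetric] mult.assoc
  proof (intro sum_mono mult_left_mono)
    fix k assume k: "k \<in> {2..L}"
    have "soft_abs e (gap m k) - soft_abs e (gap n k) \<le> \<bar>gap m k - gap n k\<bar>"
      by (rule soft_abs_lipschitz[OF e_pos])
    also have "\<dots> = \<bar>target (u m) k - target (u n) k\<bar>"
      using eq k by (simp add: gap_def abs_minus_commute)
    also have "\<dots> \<le> rho k / (1 - rho k) * \<bar>u m - u n\<bar>"
      using k by (intro target_lipschitz) auto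
    finally show "soft_abs e (gap m k) - soft_abs e (gap n k) \<le> rho k / (1 - rho k) * \<bar>u m - u n\<bar>" .
    show "0 \<le> weight k" using weight_pos[of k] k by simp
  qed
qed

text \<open>
  Covers the jumps of the classes 0 and 1, which move one of the two loads by at most \<open>a k \<le> 1\<close>.
\<close>

definition neighbour :: "(nat \<Rightarrow> nat) \<Rightarrow> (nat \<Rightarrow> nat) \<Rightarrow> bool" where
  "neighbour n m \<longleftrightarrow> (\<forall>k\<in>{2..L}. x m k = x n k) \<and> \<bar>x m 0 - x n 0\<bar> + \<bar>x m 1 - x n 1\<bar> \<le> 1"

lemma neighbour_upd:
  assumes k: "k < 2" "k \<le> L" and v: "\<bar>real v - real (n k)\<bar> \<le> 1"
  shows "neighbour n (n(k := v))"
proof -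
  have "x (n(k := v)) k - x n k = a k * (real v - real (n k))"
    using k by (simp add: x_def right_diff_distrib)
  also have "\<bar>\<dots>\<bar> \<le> 1 * 1"
    unfolding abs_mult using v a_pos[OF k(2)] a_le_1[OF k(2)] by (intro mult_mono) auto
  finally have d: "\<bar>x (n(k := v)) k - x n k\<bar> \<le> 1" by simp
  consider "k = 0" | "k = 1" using k by linarith
  then show ?thesis
    using d k by cases (simp_all add: neighbour_def x_other)
qed

lemma neighbour_S_u:
  assumes "neighbour n m"
  shows "S m \<le> S n + 1" "\<bar>u m - u n\<bar> \<le> 2 / S n"
proof -
  have d: "\<bar>x m 0 - x n 0\<bar> + \<bar>x m 1 - x n 1\<bar> \<le> 1" using assms by (simp add: neighbour_def)
  have dS: "\<bar>S m - S n\<bar> \<le> 1"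
    using d unfolding S_def by (auto simp: max_def abs_if split: if_splits)
  then show "S m \<le> S n + 1" by linarith
  have pos: "0 < S n" "0 < S m" using S_ge_1[of n] S_ge_1[of m] by linarith+
  let ?v = "(x m 0 - x n 0) / S n" and ?w = "(S n - S m) / S n"
  have split: "u m - u n = ?v + u m * ?w"
    using pos by (simp add: u_eq field_simps)
  have "\<bar>x m 0 - x n 0\<bar> \<le> 1" using d by linarith
  then have v: "\<bar>?v\<bar> \<le> 1 / S n" using pos by (simp add: abs_divide divide_right_mono)
  have "\<bar>S n - S m\<bar> \<le> 1" using dS by linarith
  then have w: "\<bar>?w\<bar> \<le> 1 / S n" using pos by (simp add: abs_divide divide_right_mono)
  have "\<bar>u m * ?w\<bar> \<le> \<bar>?w\<bar>"
    unfolding abs_mult using u_bounds[of m] by (intro mult_left_le_one_le) auto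
  then have "\<bar>u m - u n\<bar> \<le> 1 / S n + 1 / S n"
    unfolding split by (intro order_trans[OF abs_triangle_ineq] add_mono v order_trans[OF _ w])
  then show "\<bar>u m - u n\<bar> \<le> 2 / S n" by simp
qed

text \<open>
  Jumps of the classes 0 and 1 shift the equilibria to which \<open>\<Phi>\<close> refers, through \<open>u\<close>. As \<open>u\<close> moves by
  at most \<open>2 / S n\<close>, the effect loses one power of \<open>S n\<close>, and so does the change of the factor
  \<open>S n ^ Suc q\<close>.
\<close>

lemma slow_jumps:
  "\<exists>B\<ge>0. \<forall>n. jump 0 (\<lambda>n. S n ^ Suc q * \<Phi> n) n + jump 1 (\<lambda>n. S n ^ Suc q * \<Phi> n) n
     \<le> B * (S n ^ q * (1 + Y n))"
proof -
  obtain K where K: "0 \<le> K" "\<And>n. \<Phi> n \<le> K * (1 + Y n)" using \<Phi>_le by blast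
  obtain K' where K': "0 \<le> K'"
    "\<And>n m. \<forall>k\<in>{2..L}. x m k = x n k \<Longrightarrow> \<Phi> m - \<Phi> n \<le> K' * \<bar>u m - u n\<bar>" using \<Phi>_slow_change by blast
  define C where "C = 2 ^ Suc q * 2 * K' + real (Suc q) * 2 ^ q * K"
  have C: "0 \<le> C" using K(1) K'(1) by (simp add: C_def)
  have change: "S m ^ Suc q * \<Phi> m - S n ^ Suc q * \<Phi> n \<le> C * (S n ^ q * (1 + Y n))"
    if nm: "neighbour n m" for n m
  proof -
    have S: "1 \<le> S n" "0 \<le> S m" "S m \<le> S n + 1"
      using S_ge_1[of n] S_ge_1[of m] neighbour_S_u[OF nm] by auto
    have S2: "S m \<le> 2 * S n" using S by linarith
    have Y: "0 \<le> Y n" by (rule Y_nonneg)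
    have "\<Phi> m - \<Phi> n \<le> K' * \<bar>u m - u n\<bar>" using nm by (intro K'(2)) (simp add: neighbour_def)
    also have "\<dots> \<le> K' * (2 / S n)" using K'(1) neighbour_S_u[OF nm] by (intro mult_left_mono)
    finally have "S m ^ Suc q * (\<Phi> m - \<Phi> n) \<le> S m ^ Suc q * (K' * (2 / S n))"
      using S by (intro mult_left_mono zero_le_power) auto
    also have "\<dots> \<le> (2 * S n) ^ Suc q * (K' * (2 / S n))"
      using S S2 K'(1) by (intro mult_right_mono power_mono mult_nonneg_nonneg) auto
    also have "\<dots> = 2 ^ Suc q * 2 * K' * S n ^ q"
      using S(1) by (simp add: power_mult_distrib field_simps)
    also have "\<dots> \<le> 2 ^ Suc q * 2 * K' * (S n ^ q * (1 + Y n))"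
      using S(1) K'(1) Y by (intro mult_left_mono mult_nonneg_nonneg) (auto simp: distrib_left)
    finally have 1: "S m ^ Suc q * (\<Phi> m - \<Phi> n) \<le> 2 ^ Suc q * 2 * K' * (S n ^ q * (1 + Y n))" .
    have "(S m ^ Suc q - S n ^ Suc q) * \<Phi> n \<le> (real (Suc q) * (2 * S n) ^ q) * \<Phi> n"
      using power_Suc_diff_le[OF S] \<Phi>_nonneg by (intro mult_right_mono) auto
    also have "\<dots> \<le> (real (Suc q) * (2 * S n) ^ q) * (K * (1 + Y n))"
      using S(1) by (intro mult_left_mono K(2)) auto
    also have "\<dots> = real (Suc q) * 2 ^ q * K * (S n ^ q * (1 + Y n))"
      by (simp add: power_mult_distrib ac_simps)
    finally have 2: "(S m ^ Suc q - S n ^ Suc q) * \<Phi> n \<le> real (Suc q) * 2 ^ q * K * (S n ^ q * (1 + Y n))" .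
    have "S m ^ Suc q * \<Phi> m - S n ^ Suc q * \<Phi> n
        = S m ^ Suc q * (\<Phi> m - \<Phi> n) + (S m ^ Suc q - S n ^ Suc q) * \<Phi> n"
      by (simp only: right_diff_distrib left_diff_distrib)
    also have "\<dots> \<le> 2 ^ Suc q * 2 * K' * (S n ^ q * (1 + Y n)) + real (Suc q) * 2 ^ q * K * (S n ^ q * (1 + Y n))"
      by (rule add_mono[OF 1 2])
    also have "\<dots> = C * (S n ^ q * (1 + Y n))" by (simp only: C_def distrib_right)
    finally show ?thesis .
  qed
  have "jump k (\<lambda>n. S n ^ Suc q * \<Phi> n) n \<le> (lam k + mu k) * C * (S n ^ q * (1 + Y n))" if k: "k < 2" "k \<le> L" for k n
  proof -
    let ?R = "C * (S n ^ q * (1 + Y n))"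
    have R: "0 \<le> ?R" using C S_ge_1[of n] Y_nonneg[of n] by (intro mult_nonneg_nonneg) auto
    have "jump k (\<lambda>n. S n ^ Suc q * \<Phi> n) n \<le> lam k * ?R + mu k * \<phi> L a k n * ?R"
      using k by (intro jump_le change neighbour_upd) auto
    also have "\<dots> \<le> lam k * ?R + mu k * 1 * ?R"
      using R k mu_pos[of k] \<phi>_le_1[of k n] by (intro add_left_mono mult_right_mono mult_left_mono) auto
    finally show ?thesis by (simp only: distrib_right mult.assoc mult_1_right mult_1_left)
  qed
  from this[of 0] this[of 1] have "jump 0 (\<lambda>n. S n ^ Suc q * \<Phi> n) n + jump 1 (\<lambda>n. S n ^ Suc q * \<Phi> n) n
     \<le> ((lam 0 + mu 0) * C + (lam 1 + mu 1) * C) * (S n ^ q * (1 + Y n))" for n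
    using L_ge by (simp only: distrib_right) (intro add_mono; simp)
  moreover have "0 \<le> (lam 0 + mu 0) * C + (lam 1 + mu 1) * C"
    using C lam_pos[of 0] lam_pos[of 1] mu_pos[of 0] mu_pos[of 1] L_ge by simp
  ultimately show ?thesis by blast
qed


section \<open>The Lyapunov function\<close>

text \<open>
  The Lyapunov function. Class 1 is weighted such that classes 0 and 1 have equal weight exactly when
  link 1 serves class 1 at rate \<open>rho 1\<close>. The corrector is multiplied by a power of \<open>S n\<close> to
  have the order of the drift of the first two terms. The last sum dominates the mixed terms in which
  the loads on the links \<open>2, \<dots>, L\<close> exceed \<open>S n\<close>.
\<close>

definition V :: "real \<Rightarrow> (nat \<Rightarrow> nat) \<Rightarrow> real" where
  "V D n = monomial q 0 n + ((1 - rho 1) / rho 1) ^ Suc q * monomial q 1 n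
     + S n ^ Suc q * \<Phi> n + D * (\<Sum>k\<in>{2..L}. monomial q k n)"

lemma V_nonneg: "0 \<le> D \<Longrightarrow> 0 \<le> V D n"
  unfolding V_def
proof (intro add_nonneg_nonneg mult_nonneg_nonneg sum_nonneg zero_le_power)
  show "0 \<le> (1 - rho 1) / rho 1" using L_ge rho_pos[of 1] rho_lt_1[of 1] by simp
  show "0 \<le> S n" using S_ge_1[of n] by linarith
qed (use L_ge in \<open>auto intro: monomial_nonneg \<Phi>_nonneg\<close>)

lemma x_le_S: "x n 0 \<le> S n" "x n 1 \<le> S n"
  unfolding S_def le_max_iff_disj using x_nonneg[of n 0] x_nonneg[of n 1] by linarith+

lemma drift_monomial: "k \<le> L \<Longrightarrow> drift (monomial q k) n = jump k (monomial q k) n"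
proof -
  assume k: "k \<le> L"
  have "jump j (monomial q k) n = 0" if "j \<noteq> k" for j
    using that by (intro jump_eq_0) (simp add: monomial_def x_other)
  then have "drift (monomial q k) n = (\<Sum>j\<le>L. if j = k then jump k (monomial q k) n else 0)"
    unfolding drift_def jump_def[symmetric] by (intro sum.cong) auto
  then show ?thesis using k by simp
qed

lemma drift_sum: "drift (\<lambda>n. \<Sum>k\<in>A. f k n) n = (\<Sum>k\<in>A. drift (f k) n)"
proof (induction A rule: infinite_finite_induct)
  case (insert k A)
  have "drift (\<lambda>n. \<Sum>j\<in>insert k A. f j n) n = drift (\<lambda>n. f k n + (\<Sum>j\<in>A. f j n)) n"
    using insert.hyps by simp
  also have "\<dots> = drift (f k) n + drift (\<lambda>n. \<Sum>j\<in>A. f j n) n" by (rule drift_add)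
  finally show ?case using insert by simp
qed (simp_all add: drift_const)

lemma drift_V:
  "drift (V D) n = jump 0 (monomial q 0) n + ((1 - rho 1) / rho 1) ^ Suc q * jump 1 (monomial q 1) n
    + drift (\<lambda>n. S n ^ Suc q * \<Phi> n) n + D * (\<Sum>k\<in>{2..L}. jump k (monomial q k) n)"
proof -
  have "drift (V D) n = drift (monomial q 0) n + ((1 - rho 1) / rho 1) ^ Suc q * drift (monomial q 1) n
    + drift (\<lambda>n. S n ^ Suc q * \<Phi> n) n + D * (\<Sum>k\<in>{2..L}. drift (monomial q k) n)"
    unfolding V_def[abs_def] by (simp only: drift_add drift_cmult drift_sum)
  moreover have "(\<Sum>k\<in>{2..L}. drift (monomial q k) n) = (\<Sum>k\<in>{2..L}. jump k (monomial q k) n)"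
    by (intro sum.cong) (auto simp: drift_monomial)
  ultimately show ?thesis using L_ge by (simp add: drift_monomial)
qed

lemma drift_corrector:
  "\<exists>B\<ge>0. \<forall>n. drift (\<lambda>n. S n ^ Suc q * \<Phi> n) n
     \<le> S n ^ Suc q * (\<eta> - \<bar>\<theta> n L - ideal (u n) L\<bar>) + B * (S n ^ q * (1 + Y n))"
proof -
  obtain B where B: "0 \<le> B" "\<And>n. jump 0 (\<lambda>n. S n ^ Suc q * \<Phi> n) n + jump 1 (\<lambda>n. S n ^ Suc q * \<Phi> n) n
     \<le> B * (S n ^ q * (1 + Y n))" using slow_jumps by blast
  have fast: "(\<Sum>k\<in>{2..L}. jump k (\<lambda>n. S n ^ Suc q * \<Phi> n) n) \<le> S n ^ Suc q * (\<eta> - \<bar>\<theta> n L - ideal (u n) L\<bar>)" for n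
  proof -
    have "jump k (\<lambda>n. S n ^ Suc q * \<Phi> n) n = S n ^ Suc q * jump k \<Phi> n" if "k \<in> {2..L}" for k
      using that S_unaffected[of k n] by (simp add: jump_def algebra_simps)
    then have "(\<Sum>k\<in>{2..L}. jump k (\<lambda>n. S n ^ Suc q * \<Phi> n) n) = S n ^ Suc q * (\<Sum>k\<in>{2..L}. jump k \<Phi> n)"
      by (simp add: sum_distrib_left)
    also have "\<dots> \<le> S n ^ Suc q * (\<eta> - \<bar>\<theta> n L - ideal (u n) L\<bar>)"
      using S_ge_1[of n] by (intro mult_left_mono fast_drift) auto
    finally show ?thesis .
  qed
  have "drift (\<lambda>n. S n ^ Suc q * \<Phi> n) n
     \<le> S n ^ Suc q * (\<eta> - \<bar>\<theta> n L - ideal (u n) L\<bar>) + B * (S n ^ q * (1 + Y n))" for n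
    unfolding drift_eq_jumps[of "\<lambda>n. S n ^ Suc q * \<Phi> n"]
    using add_mono[OF B(2)[of n] fast[of n]] by linarith
  then show ?thesis using B(1) by blast
qed

lemma planar_monomials:
  "\<exists>B\<ge>0. \<forall>n. jump 0 (monomial q 0) n + ((1 - rho 1) / rho 1) ^ Suc q * jump 1 (monomial q 1) n
    \<le> x n 0 ^ Suc q * (rho 0 - \<theta> n L)
      + (x n 1 * (1 - rho 1) / rho 1) ^ Suc q * (rho 1 - \<phi> L a 1 n) + B * S n ^ q"
proof -
  define r where "r = ((1 - rho 1) / rho 1) ^ Suc q"
  have r: "0 \<le> r" unfolding r_def using rho_pos[of 1] rho_lt_1[of 1] L_ge
    by (intro zero_le_power divide_nonneg_nonneg) auto
  let ?c = "2 * real (Suc (Suc q)) * 2 ^ q"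
  have small: "2 * real (Suc (Suc q)) * (1 + x n k) ^ q \<le> ?c * S n ^ q" if "k = 0 \<or> k = 1" for n k
  proof -
    have "1 + x n k \<le> 2 * S n"
      using that x_le_S[of n] S_ge_1[of n] by (elim disjE) simp_all
    then have "(1 + x n k) ^ q \<le> (2 * S n) ^ q" by (intro power_mono) auto
    then show ?thesis by (simp add: power_mult_distrib)
  qed
  have le0: "0 \<le> L" by simp
  have sum_le: "jump 0 (monomial q 0) n + r * jump 1 (monomial q 1) n
    \<le> (x n 0 ^ Suc q * (rho 0 - \<theta> n L) + ?c * S n ^ q)
      + r * (x n 1 ^ Suc q * (rho 1 - \<phi> L a 1 n) + ?c * S n ^ q)" for n
  proof (intro add_mono mult_left_mono r)
    show "jump 0 (monomial q 0) n \<le> x n 0 ^ Suc q * (rho 0 - \<theta> n L) + ?c * S n ^ q"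
      using jump_monomial[OF le0 a_le_1[OF le0] less_imp_le[OF rho_0_lt_1], of q n] small[of 0 n]
      unfolding \<phi>_0 by linarith
    show "jump 1 (monomial q 1) n \<le> x n 1 ^ Suc q * (rho 1 - \<phi> L a 1 n) + ?c * S n ^ q"
      using jump_monomial[OF L_ge a_le_1[OF L_ge] less_imp_le[OF rho_lt_1[OF order_refl L_ge]], of q n]
        small[of 1 n] by linarith
  qed
  have factor: "r * (x n 1 ^ Suc q * (rho 1 - \<phi> L a 1 n))
      = (x n 1 * (1 - rho 1) / rho 1) ^ Suc q * (rho 1 - \<phi> L a 1 n)" for n
  proof -
    have "x n 1 * (1 - rho 1) / rho 1 = x n 1 * ((1 - rho 1) / rho 1)" by simp
    then show ?thesis by (simp only: r_def power_mult_distrib mult.assoc mult.left_commute)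
  qed
  have "(P + c * s) + r * (Q + c * s) = P + r * Q + (c + r * c) * s" for P Q c s
    by (simp add: algebra_simps)
  then have "jump 0 (monomial q 0) n + r * jump 1 (monomial q 1) n
    \<le> x n 0 ^ Suc q * (rho 0 - \<theta> n L)
      + (x n 1 * (1 - rho 1) / rho 1) ^ Suc q * (rho 1 - \<phi> L a 1 n) + (?c + r * ?c) * S n ^ q" for n
    using sum_le[of n] factor[of n] by (simp only:)
  then show ?thesis unfolding r_def[symmetric] using r by (intro exI[of _ "?c + r * ?c"]) auto
qed

lemma outer_monomials:
  "\<exists>C. \<forall>n. (\<Sum>k\<in>{2..L}. jump k (monomial q k) n) \<le> - (\<delta> / 2) * (\<Sum>k\<in>{2..L}. x n k ^ Suc q) + C"
proof -
  have "\<exists>C. \<forall>n. jump k (monomial q k) n \<le> - (\<delta> / 2) * x n k ^ Suc q + C" if k: "k \<in> {2..L}" for k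
  proof -
    have k': "1 \<le> k" "k \<le> L" "1 \<le> k - 1" using k by auto
    obtain C where C: "\<And>x t. 0 \<le> x \<Longrightarrow> 0 \<le> t \<Longrightarrow> t \<le> 1 \<Longrightarrow> x ^ Suc q * (rho k - share t x)
        + 2 * real (Suc (Suc q)) * (1 + x) ^ q \<le> - ((1 - rho k) / 2) * x ^ Suc q + C"
      using large_queue_drains[OF rho_lt_1[OF k'(1,2)], of "2 * real (Suc (Suc q))" q] by auto
    have "jump k (monomial q k) n \<le> - (\<delta> / 2) * x n k ^ Suc q + C" for n
    proof -
      have "jump k (monomial q k) n \<le> x n k ^ Suc q * (rho k - share (\<theta> n (k - 1)) (x n k))
          + 2 * real (Suc (Suc q)) * (1 + x n k) ^ q"
        using jump_monomial[OF k'(2), of q n] a_le_1[OF k'(2)] rho_lt_1[OF k'(1,2)]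
        unfolding \<phi>_pos_eq[OF k'(1,2)] by simp
      also have "\<dots> \<le> - ((1 - rho k) / 2) * x n k ^ Suc q + C"
        by (intro C \<theta>_le_1 k'(3)) simp_all
      also have "- ((1 - rho k) / 2) * x n k ^ Suc q \<le> - (\<delta> / 2) * x n k ^ Suc q"
        using load[OF k'(1,2)] rho_pos[of 0] by (intro mult_right_mono zero_le_power) auto
      finally show ?thesis by simp
    qed
    then show ?thesis by blast
  qed
  then obtain C where C: "\<And>k n. k \<in> {2..L} \<Longrightarrow> jump k (monomial q k) n \<le> - (\<delta> / 2) * x n k ^ Suc q + C k"
    by metis
  have "(\<Sum>k\<in>{2..L}. jump k (monomial q k) n) \<le> - (\<delta> / 2) * (\<Sum>k\<in>{2..L}. x n k ^ Suc q) + (\<Sum>k\<in>{2..L}. C k)" for n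
    unfolding sum_distrib_left sum.distrib[symmetric] by (intro sum_mono C)
  then show ?thesis by blast
qed

text \<open>
  Young's inequality splits the lower-order terms into a small multiple of \<open>S n ^ Suc q\<close>, paid by
  classes 0 and 1, and powers of the other loads, paid by the last sum of \<open>V\<close>.
\<close>

lemma mixed_terms:
  assumes "0 \<le> B"
  shows "\<exists>E\<ge>0. \<forall>n. B * (S n ^ q * (1 + Y n)) \<le> \<eta> / 2 * S n ^ Suc q + E * (1 + (\<Sum>k\<in>{2..L}. x n k ^ Suc q))"
proof -
  \<comment> \<open>The factors B + 1 and L + 1 bound the coefficient and the number of the terms to be split.\<close>
  define \<kappa> where "\<kappa> = \<eta> / (2 * (B + 1) * real (Suc L))"
  have \<kappa>: "0 < \<kappa>" using \<eta>_pos assms by (simp add: \<kappa>_def)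
  let ?K = "(1 / \<kappa>) ^ q"
  have bound: "B * (S n ^ q * (1 + Y n)) \<le> \<eta> / 2 * S n ^ Suc q + B * ?K * (1 + (\<Sum>k\<in>{2..L}. x n k ^ Suc q))" for n
  proof -
    let ?s = "S n" and ?X = "\<Sum>k\<in>{2..L}. x n k ^ Suc q"
    have s: "0 \<le> ?s" using S_ge_1[of n] by linarith
    have "?s ^ q * (1 + Y n) = ?s ^ q * 1 + (\<Sum>k\<in>{2..L}. ?s ^ q * x n k)"
      by (simp add: Y_def distrib_left sum_distrib_left)
    also have "\<dots> \<le> (\<kappa> * ?s ^ Suc q + ?K * 1 ^ Suc q) + (\<Sum>k\<in>{2..L}. \<kappa> * ?s ^ Suc q + ?K * x n k ^ Suc q)"
      using s \<kappa> by (intro add_mono sum_mono power_mult_le_Young) auto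
    also have "(\<Sum>k\<in>{2..L}. \<kappa> * ?s ^ Suc q + ?K * x n k ^ Suc q)
        = real (card {2..L}) * (\<kappa> * ?s ^ Suc q) + ?K * ?X"
      by (simp only: sum.distrib sum_constant sum_distrib_left)
    also have "(\<kappa> * ?s ^ Suc q + ?K * 1 ^ Suc q) + (real (card {2..L}) * (\<kappa> * ?s ^ Suc q) + ?K * ?X)
        = (1 + real (card {2..L})) * (\<kappa> * ?s ^ Suc q) + ?K * (1 + ?X)"
      by (simp only: distrib_left distrib_right power_one mult_1_left mult_1_right ac_simps)
    finally have 1: "?s ^ q * (1 + Y n) \<le> (1 + real (card {2..L})) * (\<kappa> * ?s ^ Suc q) + ?K * (1 + ?X)" .
    have "(1 + real (card {2..L})) * (\<kappa> * ?s ^ Suc q) \<le> real (Suc L) * (\<kappa> * ?s ^ Suc q)"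
      using s \<kappa> by (intro mult_right_mono mult_nonneg_nonneg zero_le_power) auto
    with 1 have "?s ^ q * (1 + Y n) \<le> real (Suc L) * (\<kappa> * ?s ^ Suc q) + ?K * (1 + ?X)" by linarith
    then have "B * (?s ^ q * (1 + Y n)) \<le> B * (real (Suc L) * (\<kappa> * ?s ^ Suc q) + ?K * (1 + ?X))"
      using assms by (rule mult_left_mono)
    also have "\<dots> = (B * real (Suc L) * \<kappa>) * ?s ^ Suc q + B * ?K * (1 + ?X)"
      by (simp only: distrib_left mult.assoc)
    finally have 2: "B * (?s ^ q * (1 + Y n)) \<le> (B * real (Suc L) * \<kappa>) * ?s ^ Suc q + B * ?K * (1 + ?X)" .
    have "B * real (Suc L) * \<kappa> = \<eta> / 2 * (B / (B + 1))"
      using assms by (simp add: \<kappa>_def divide_simps)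
    also have "\<dots> \<le> \<eta> / 2 * 1"
      using assms \<eta>_pos by (intro mult_left_mono) auto
    finally have "(B * real (Suc L) * \<kappa>) * ?s ^ Suc q \<le> \<eta> / 2 * ?s ^ Suc q"
      using s by (intro mult_right_mono zero_le_power) auto
    with 2 show ?thesis by linarith
  qed
  have "0 \<le> B * ?K" using assms \<kappa> by simp
  then show ?thesis using bound by blast
qed

lemma drift_bound:
  "\<exists>D\<ge>0. \<exists>C. \<forall>n. drift (V D) n \<le> C - \<eta> / 2 * S n ^ Suc q - (\<Sum>k\<in>{2..L}. x n k ^ Suc q)"
proof -
  obtain C1 where C1: "\<And>n. x n 0 ^ Suc q * (rho 0 - \<theta> n L)
      + (x n 1 * (1 - rho 1) / rho 1) ^ Suc q * (rho 1 - \<phi> L a 1 n)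
      + S n ^ Suc q * (\<eta> - \<bar>\<theta> n L - ideal (u n) L\<bar>) \<le> - \<eta> * S n ^ Suc q + C1"
    using planar_drift by blast
  obtain B1 where B1: "0 \<le> B1" "\<And>n. drift (\<lambda>n. S n ^ Suc q * \<Phi> n) n
     \<le> S n ^ Suc q * (\<eta> - \<bar>\<theta> n L - ideal (u n) L\<bar>) + B1 * (S n ^ q * (1 + Y n))"
    using drift_corrector by blast
  obtain B2 where B2: "0 \<le> B2" "\<And>n. jump 0 (monomial q 0) n + ((1 - rho 1) / rho 1) ^ Suc q * jump 1 (monomial q 1) n
    \<le> x n 0 ^ Suc q * (rho 0 - \<theta> n L)
      + (x n 1 * (1 - rho 1) / rho 1) ^ Suc q * (rho 1 - \<phi> L a 1 n) + B2 * S n ^ q"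
    using planar_monomials by blast
  obtain C2 where C2: "\<And>n. (\<Sum>k\<in>{2..L}. jump k (monomial q k) n)
      \<le> - (\<delta> / 2) * (\<Sum>k\<in>{2..L}. x n k ^ Suc q) + C2"
    using outer_monomials by blast
  obtain E where E: "0 \<le> E" "\<And>n. (B1 + B2) * (S n ^ q * (1 + Y n))
      \<le> \<eta> / 2 * S n ^ Suc q + E * (1 + (\<Sum>k\<in>{2..L}. x n k ^ Suc q))"
    using mixed_terms[of "B1 + B2"] B1(1) B2(1) by auto
  \<comment> \<open>With this choice the last sum of V pays E times the powers of the loads and leaves one
    copy of them.\<close>
  define D where "D = 2 * (E + 1) / \<delta>"
  have D: "0 \<le> D" "D * (\<delta> / 2) = E + 1" using E(1) \<delta>_pos by (auto simp: D_def)
  have "drift (V D) n \<le> (C1 + D * C2 + E) - \<eta> / 2 * S n ^ Suc q - (\<Sum>k\<in>{2..L}. x n k ^ Suc q)" for n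
  proof -
    define X J where "X = (\<Sum>k\<in>{2..L}. x n k ^ Suc q)" and "J = (\<Sum>k\<in>{2..L}. jump k (monomial q k) n)"
    have "D * J \<le> D * (- (\<delta> / 2) * X + C2)"
      unfolding J_def X_def using C2 D(1) by (intro mult_left_mono)
    also have "\<dots> = - (D * (\<delta> / 2)) * X + D * C2" by (simp add: algebra_simps)
    also have "\<dots> = - (E * X) - X + D * C2" unfolding D(2) by (simp add: algebra_simps)
    finally have J: "D * J \<le> - (E * X) - X + D * C2" .
    have "S n ^ q * 1 \<le> S n ^ q * (1 + Y n)"
      using S_ge_1[of n] Y_nonneg[of n] by (intro mult_left_mono zero_le_power) auto
    then have "B2 * S n ^ q \<le> B2 * (S n ^ q * (1 + Y n))" using B2(1) by (intro mult_left_mono) auto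
    then have M: "B1 * (S n ^ q * (1 + Y n)) + B2 * S n ^ q \<le> \<eta> / 2 * S n ^ Suc q + E + E * X"
      using E(2)[of n] unfolding X_def[symmetric] distrib_right[of B1] distrib_left[of E] mult_1_right
      by linarith
    have h: "- \<eta> * S n ^ Suc q = - (\<eta> / 2 * S n ^ Suc q) - \<eta> / 2 * S n ^ Suc q" by (simp add: field_simps)
    show ?thesis
      unfolding drift_V X_def[symmetric] J_def[symmetric] using J M C1[of n, unfolded h] B1(2)[of n] B2(2)[of n]
      by linarith
  qed
  then show ?thesis using D(1) by blast
qed

section \<open>Ergodicity\<close>

lemma finite_bounded_states:
  "finite {n \<in> states L. \<forall>k\<le>L. x n k \<le> R}"
proof (rule finite_subset)
  define N where "N = Max ((\<lambda>k. nat \<lceil>R / a k\<rceil>) ` {..L})"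
  have "n k \<le> N" if "n \<in> states L" "\<And>k. k \<le> L \<Longrightarrow> x n k \<le> R" "k \<le> L" for n k
  proof -
    have "real (n k) \<le> R / a k"
      using that(2)[OF that(3)] a_pos[OF that(3)] that(3) by (simp add: x_def le_divide_eq mult.commute)
    then have "n k \<le> nat \<lceil>R / a k\<rceil>" by linarith
    also have "\<dots> \<le> N" unfolding N_def using that(3) by (intro Max_ge) auto
    finally show ?thesis .
  qed
  then show "{n \<in> states L. \<forall>k\<le>L. x n k \<le> R} \<subseteq> {f. \<forall>k. (k \<in> {..L} \<longrightarrow> f k \<in> {..N}) \<and> (k \<notin> {..L} \<longrightarrow> f k = 0)}"
    by (auto simp: states_def)
  show "finite {f. \<forall>k. (k \<in> {..L} \<longrightarrow> f k \<in> {..N}) \<and> (k \<notin> {..L} \<longrightarrow> f k = 0)}"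
    by (rule finite_set_of_finite_funs) auto
qed

theorem network_ergodic: "ergodic (states L) rate"
proof -
  obtain D C where D: "0 \<le> D"
    and drift: "\<And>n. drift (V D) n \<le> C - \<eta> / 2 * S n ^ Suc q - (\<Sum>k\<in>{2..L}. x n k ^ Suc q)"
    using drift_bound by blast
  define R where "R = max 1 (max (2 * (C + 1) / \<eta>) (C + 1))"
  have le_power: "z \<le> z ^ Suc q" if "1 \<le> z" for z :: real
    using self_le_power[of z "Suc q"] that by simp
  have "x n k \<le> R" if big: "\<not> drift (V D) n \<le> -1" and k: "k \<le> L" for n k
  proof -
    let ?X = "\<Sum>k\<in>{2..L}. x n k ^ Suc q"
    have X: "0 \<le> ?X" by (intro sum_nonneg zero_le_power) simp
    have S: "S n \<le> S n ^ Suc q" by (rule le_power[OF S_ge_1])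
    have S': "0 \<le> \<eta> / 2 * S n ^ Suc q" using \<eta>_pos S_ge_1[of n] by simp
    have less: "\<eta> / 2 * S n ^ Suc q + ?X < C + 1" using drift[of n] big by linarith
    show ?thesis
    proof (cases "k < 2")
      case True
      then have "k = 0 \<or> k = 1" by auto
      then have "x n k \<le> S n" using x_le_S[of n] by auto
      also have "S n \<le> 2 * (C + 1) / \<eta>"
      proof -
        have "\<eta> / 2 * S n \<le> \<eta> / 2 * S n ^ Suc q" using S \<eta>_pos by (intro mult_left_mono) auto
        then have "\<eta> * S n \<le> 2 * (C + 1)" using less X by simp
        then show ?thesis using \<eta>_pos by (simp add: le_divide_eq mult.commute)
      qed
      finally show ?thesis by (simp add: R_def)
    next
      case False
      then have "x n k ^ Suc q \<le> ?X" using k by (intro member_le_sum zero_le_power) auto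
      then have "x n k ^ Suc q \<le> C + 1" using less S' by linarith
      then have "x n k \<le> C + 1 \<or> x n k \<le> 1" using le_power[of "x n k"] by linarith
      then show ?thesis by (auto simp: R_def)
    qed
  qed
  then have "{n \<in> states L. \<not> drift (V D) n \<le> -1} \<subseteq> {n \<in> states L. \<forall>k\<le>L. x n k \<le> R}" by blast
  then have "finite {n \<in> states L. \<not> drift (V D) n \<le> -1}"
    using finite_bounded_states by (rule finite_subset)
  then show ?thesis by (intro ergodic_if_drift[of "V D"] V_nonneg D)
qed

end

text \<open>
  Order of the choices: the margin \<open>\<delta>\<close> comes from the load condition, then \<open>q\<close> and \<open>\<eta>\<close> from the planar
  inequality, then the smoothing width \<open>e\<close>, and finally \<open>\<epsilon> \<le> e\<^sup>2\<close>, such that the discretisation error \<open>\<epsilon> / e\<close>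
  does not exceed \<open>e\<close>.
\<close>

theorem theorem4:
  fixes L :: nat and lam mu :: "nat \<Rightarrow> real"
  assumes "2 \<le> L"
    and "\<And>k. k \<le> L \<Longrightarrow> 0 < lam k"
    and "\<And>k. k \<le> L \<Longrightarrow> 0 < mu k"
    and "\<And>k. 1 \<le> k \<Longrightarrow> k \<le> L \<Longrightarrow> lam 0 / mu 0 + lam k / mu k < 1"
  shows "\<exists>\<epsilon>>0. \<forall>a :: nat \<Rightarrow> real.
           (\<forall>k\<le>L. 0 < a k \<and> a k \<le> \<epsilon>) \<longrightarrow> ergodic (states L) (network_rate L lam mu a)"
proof -
  let ?r = "\<lambda>k. lam k / mu k"
  define \<delta> where "\<delta> = Min ((\<lambda>k. 1 - ?r 0 - ?r k) ` {1..L})"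
  have \<delta>: "0 < \<delta>" unfolding \<delta>_def using assms(1,4) by (subst Min_gr_iff) (auto simp: algebra_simps)
  have load: "?r 0 + \<delta> \<le> 1 - ?r k" if "1 \<le> k" "k \<le> L" for k
  proof -
    have "\<delta> \<le> 1 - ?r 0 - ?r k" unfolding \<delta>_def using that by (intro Min_le) auto
    then show ?thesis by simp
  qed
  have "0 < ?r 0" "0 < ?r 1" using assms(1-3) by auto
  then obtain q \<eta> where \<eta>: "0 < \<eta>" and planar: "\<And>v. 0 \<le> v \<Longrightarrow> v \<le> 1 \<Longrightarrow>
      v ^ Suc q * (?r 0 - min v (?r 0 + \<delta>)) + ((1 - v) * (1 - ?r 1) / ?r 1) ^ Suc q * (?r 1 - (1 - v)) \<le> - 2 * \<eta>"
    using planar_weights[of "?r 0" "?r 1" \<delta>] \<delta> load[of 1] assms(1) by fastforce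
  \<comment> \<open>Half of the margin is for the smoothing error, the other half for the discretisation error.\<close>
  define e where "e = \<eta> / (2 * 2 ^ L)"
  define \<epsilon> where "\<epsilon> = min 1 (e * e)"
  have e: "0 < e" using \<eta> by (simp add: e_def)
  show ?thesis
  proof (intro exI[of _ \<epsilon>] conjI allI impI)
    show "0 < \<epsilon>" using e by (simp add: \<epsilon>_def)
    fix a :: "nat \<Rightarrow> real" assume a: "\<forall>k\<le>L. 0 < a k \<and> a k \<le> \<epsilon>"
    interpret linear_network L lam mu a
      using assms a by unfold_locales auto
    have small: "2 ^ L * (e + a k / e) \<le> \<eta>" if "k \<le> L" for k
    proof -
      have "a k \<le> e * e" using a that by (auto simp: \<epsilon>_def)
      then have "a k / e \<le> e" using e by (simp add: divide_le_eq)
      then have "2 ^ L * (e + a k / e) \<le> 2 ^ L * (e + e)" by (intro mult_left_mono) auto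
      also have "\<dots> = \<eta>" by (simp add: e_def)
      finally show ?thesis .
    qed
    interpret lyapunov L lam mu a \<delta> e \<eta> q
    proof unfold_locales
      show "rho 0 + \<delta> \<le> 1 - rho k" if "1 \<le> k" "k \<le> L" for k
        using load[OF that] by (simp add: rho_def)
      show "a k \<le> 1" if "k \<le> L" for k using a that by (auto simp: \<epsilon>_def)
      show "v ^ Suc q * (rho 0 - min v (rho 0 + \<delta>)) + ((1 - v) * (1 - rho 1) / rho 1) ^ Suc q * (rho 1 - (1 - v)) \<le> - 2 * \<eta>"
        if "0 \<le> v" "v \<le> 1" for v
        using planar[OF that] by (simp only: rho_def)
    qed (fact \<delta> e \<eta> small)+
    show "ergodic (states L) (network_rate L lam mu a)" by (rule network_ergodic)
  qed
qed

end
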